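(* Let $k$ be a field of characteristic zero, $R=k[x_1,\ldots,x_n]$ with the degree reverse lexicographic order induced by $x_1\succ\cdots\succ x_n$, and $S=k[X_1,\ldots,X_n]$. For any $e\ge 1$, let $H_e\in S$ be the complete symmetric polynomial of degree $e$. If $G\in S$ is a generic form of degree $e$, then $$\operatorname{in}(\operatorname{Ann}(G))=\operatorname{in}(\operatorname{Ann}(H_e)).$$ Moreover, if $e=2d$ is even, then $$\mathcal G_{2d}=\{\varphi(F_{\underline a}):|\underline a|=d+1\}\cup\{\varphi(x_n^{2i+1}F_{\underline a}): i=0,\ldots,d\text{ and }|\underline a|=d-i\}$$ is a minimal Gröbner basis for $\operatorname{Ann}(H_{2d})$. If $e=2d+1$ is odd, then $$\mathcal G_{2d+1}=\{\varphi(x_n^{2i}F_{\underline a}): i=0,\ldots,d+1\text{ and }|\underline a|=d+1-i\}$$ is a minimal Gröbner basis for $\operatorname{Ann}(H_{2d+1})$.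
   Context: $S$ is an $R$-module via differentiation: $x_i\circ g=\frac{\partial}{\partial X_i}g$. For $G\in S$, $\operatorname{Ann}(G)=\{f\in R:f\circ G=0\}$, and $\operatorname{in}$ denotes the initial ideal (generated by leading monomials). The complete symmetric polynomial is $H_e=\sum_{\underline i\in\mathbb N^n,\,|\underline i|=e}X_1^{i_1}\cdots X_n^{i_n}$, where $\mathbb N$ includes $0$ and $|\underline i|$ is the sum of the entries. The map $\varphi:R\to R$ is the $k$-linear map with $\varphi(x_1^{i_1}\cdots x_n^{i_n})=\frac{1}{i_1!\cdots i_n!}x_1^{i_1}\cdots x_n^{i_n}$. For $\underline a=(a_1,\ldots,a_{n-1})\in\mathbb N^{n-1}$, $F_{\underline a}=(x_1-x_n)^{a_1}\cdots(x_{n-1}-x_n)^{a_{n-1}}\in R$ and $|\underline a|=a_1+\cdots+a_{n-1}$. A minimal Gröbner basis of an ideal $I$ is a Gröbner basis whose elements have pairwise distinct leading monomials forming the minimal monomial generating set of $\operatorname{in}(I)$ (leading coefficients are not required to be $1$). "Generic form of degree $e$" means: there is a nonzero polynomial $P$ over $k$ in the coefficients of a degree $e$ form such that the assertion holds for every $G\in S_e$ whose coefficients do not annihilate $P$. *)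

theory Defs
  imports "HOL-Library.Poly_Mapping" "HOL-Algebra.Ideal"
begin

(* Multi-indices (and the corresponding monomials) are finitely supported functions
   into nat; a polynomial is a finitely supported function from monomials to
   coefficients, with the convolution product of HOL-Library.Poly_Mapping. *)

type_synonym 'v mono = "'v \<Rightarrow>\<^sub>0 nat"
type_synonym ('v, 'k) mpoly = "'v mono \<Rightarrow>\<^sub>0 'k"

abbreviation lookup :: "('a \<Rightarrow>\<^sub>0 'b::zero) \<Rightarrow> 'a \<Rightarrow> 'b" where
  "lookup \<equiv> Poly_Mapping.lookup"

abbreviation keys :: "('a \<Rightarrow>\<^sub>0 'b::zero) \<Rightarrow> 'a set" where
  "keys \<equiv> Poly_Mapping.keys"

definition mdeg :: "'v mono \<Rightarrow> nat" where
  "mdeg m = (\<Sum>i\<in>keys m. lookup m i)"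

(* The set of all i in N^n with |i| = e; the positions of a multi-index are 1, ..., n. *)
definition multi_indices :: "nat \<Rightarrow> nat \<Rightarrow> nat mono set" where
  "multi_indices n e = {m. keys m \<subseteq> {1..n} \<and> mdeg m = e}"

definition Var :: "'v \<Rightarrow> ('v, 'k::comm_ring_1) mpoly" where
  "Var i = Poly_Mapping.single (Poly_Mapping.single i 1) 1"

definition vars :: "('v, 'k::zero) mpoly \<Rightarrow> 'v set" where
  "vars p = (\<Union>m\<in>keys p. keys m)"

(* k[x_1, ..., x_n] as a subring of the polynomials in countably many variables.
   R and S are two copies of this ring, so both are represented by it. *)
definition poly_ring :: "nat \<Rightarrow> (nat, 'k::comm_ring_1) mpoly ring" where
  "poly_ring n = \<lparr>carrier = {p. vars p \<subseteq> {1..n}}, mult = (*), one = 1, zero = 0, add = (+)\<rparr>"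

definition forms :: "nat \<Rightarrow> nat \<Rightarrow> (nat, 'k::comm_ring_1) mpoly set" where
  "forms n e = {G. keys G \<subseteq> multi_indices n e}"

definition poly_eval :: "('v, 'k::comm_ring_1) mpoly \<Rightarrow> ('v \<Rightarrow> 'k) \<Rightarrow> 'k" where
  "poly_eval P c = (\<Sum>m\<in>keys P. lookup P m * (\<Prod>v\<in>keys m. c v ^ lookup m v))"

(* Q holds for a generic form of degree e.  The variables of P are the monomials of
   degree e, standing for the coefficients of a form. *)
definition generic_form :: "nat \<Rightarrow> nat \<Rightarrow> ((nat, 'k::comm_ring_1) mpoly \<Rightarrow> bool) \<Rightarrow> bool" where
  "generic_form n e Q \<longleftrightarrow>
     (\<exists>P :: (nat mono, 'k) mpoly. P \<noteq> 0 \<and> vars P \<subseteq> multi_indices n e \<and>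
        (\<forall>G\<in>forms n e. poly_eval P (lookup G) \<noteq> 0 \<longrightarrow> Q G))"

(* Partial derivative.  Subtraction of exponents truncates at 0, but then the
   coefficient vanishes. *)
definition partial :: "'v \<Rightarrow> ('v, 'k::comm_ring_1) mpoly \<Rightarrow> ('v, 'k) mpoly" where
  "partial i g = (\<Sum>m\<in>keys g.
     Poly_Mapping.single (m - Poly_Mapping.single i 1) (of_nat (lookup m i) * lookup g m))"

definition mono_act :: "nat mono \<Rightarrow> (nat, 'k::comm_ring_1) mpoly \<Rightarrow> (nat, 'k) mpoly" where
  "mono_act m g = foldr (\<lambda>i. partial i ^^ lookup m i) (sorted_list_of_set (keys m)) g"

(* The module action f \<circ> g; the factor Poly_Mapping.single 0 c is the constant c. *)
definition act :: "(nat, 'k::comm_ring_1) mpoly \<Rightarrow> (nat, 'k) mpoly \<Rightarrow> (nat, 'k) mpoly" where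
  "act f g = (\<Sum>m\<in>keys f. Poly_Mapping.single 0 (lookup f m) * mono_act m g)"

definition Ann :: "nat \<Rightarrow> (nat, 'k::comm_ring_1) mpoly \<Rightarrow> (nat, 'k) mpoly set" where
  "Ann n G = {f \<in> carrier (poly_ring n). act f G = 0}"

(* Degree reverse lexicographic order with x_1 > x_2 > ... *)
definition drl_less :: "nat mono \<Rightarrow> nat mono \<Rightarrow> bool" where
  "drl_less s t \<longleftrightarrow> mdeg s < mdeg t \<or>
     mdeg s = mdeg t \<and> (\<exists>i. lookup t i < lookup s i \<and> (\<forall>j>i. lookup s j = lookup t j))"

(* Meaningful for f \<noteq> 0 only. *)
definition lead_mono :: "(nat, 'k::zero) mpoly \<Rightarrow> nat mono" where
  "lead_mono f = (THE m. m \<in> keys f \<and> (\<forall>m'\<in>keys f. m' \<noteq> m \<longrightarrow> drl_less m' m))"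

definition mono_ideal :: "nat \<Rightarrow> nat mono set \<Rightarrow> (nat, 'k::comm_ring_1) mpoly set" where
  "mono_ideal n M = Idl\<^bsub>poly_ring n\<^esub> ((\<lambda>m. Poly_Mapping.single m 1) ` M)"

definition initial_ideal ::
    "nat \<Rightarrow> (nat, 'k::comm_ring_1) mpoly set \<Rightarrow> (nat, 'k) mpoly set" where
  "initial_ideal n I = mono_ideal n (lead_mono ` (I - {0}))"

definition groebner_basis ::
    "nat \<Rightarrow> (nat, 'k::comm_ring_1) mpoly set \<Rightarrow> (nat, 'k) mpoly set \<Rightarrow> bool" where
  "groebner_basis n B I \<longleftrightarrow>
     finite B \<and> B \<subseteq> I \<and> 0 \<notin> B \<and> mono_ideal n (lead_mono ` B) = initial_ideal n I"

definition minimal_mono_gens ::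
    "nat \<Rightarrow> nat mono set \<Rightarrow> (nat, 'k::comm_ring_1) mpoly set \<Rightarrow> bool" where
  "minimal_mono_gens n M J \<longleftrightarrow>
     (\<forall>m\<in>M. keys m \<subseteq> {1..n}) \<and> mono_ideal n M = J \<and> (\<forall>M'. M' \<subset> M \<longrightarrow> mono_ideal n M' \<noteq> J)"

definition minimal_groebner_basis ::
    "nat \<Rightarrow> (nat, 'k::comm_ring_1) mpoly set \<Rightarrow> (nat, 'k) mpoly set \<Rightarrow> bool" where
  "minimal_groebner_basis n B I \<longleftrightarrow>
     groebner_basis n B I \<and> inj_on lead_mono B \<and>
     minimal_mono_gens n (lead_mono ` B) (initial_ideal n I)"

definition complete_sym :: "nat \<Rightarrow> nat \<Rightarrow> (nat, 'k::comm_ring_1) mpoly" where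
  "complete_sym n e = (\<Sum>m\<in>multi_indices n e. Poly_Mapping.single m 1)"

definition phi :: "('v, 'k::field_char_0) mpoly \<Rightarrow> ('v, 'k) mpoly" where
  "phi f = (\<Sum>m\<in>keys f. Poly_Mapping.single m (lookup f m / (\<Prod>i\<in>keys m. fact (lookup m i))))"

(* F_a for a in N^(n-1), that is a \<in> multi_indices (n - 1) |a|. *)
definition F :: "nat \<Rightarrow> nat mono \<Rightarrow> (nat, 'k::comm_ring_1) mpoly" where
  "F n a = (\<Prod>i\<in>{1..n - 1}. (Var i - Var n) ^ lookup a i)"

definition G_even :: "nat \<Rightarrow> nat \<Rightarrow> (nat, 'k::field_char_0) mpoly set" where
  "G_even n d =
     {phi (F n a) | a. a \<in> multi_indices (n - 1) (d + 1)} \<union>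
     {phi (Var n ^ (2 * i + 1) * F n a) | i a. i \<le> d \<and> a \<in> multi_indices (n - 1) (d - i)}"

definition G_odd :: "nat \<Rightarrow> nat \<Rightarrow> (nat, 'k::field_char_0) mpoly set" where
  "G_odd n d =
     {phi (Var n ^ (2 * i) * F n a) | i a. i \<le> d + 1 \<and> a \<in> multi_indices (n - 1) (d + 1 - i)}"

(* The sum defining complete_sym is a genuine finite sum. *)
lemma finite_multi_indices: "finite (multi_indices n e)"
proof -
  have "multi_indices n e \<subseteq> lookup -` {f. \<forall>i. (i \<in> {1..n} \<longrightarrow> f i \<in> {0..e}) \<and> (i \<notin> {1..n} \<longrightarrow> f i = 0)}"
  proof
    fix m assume m: "m \<in> multi_indices n e"
    have "lookup m i \<le> e" for i
    proof (cases "i \<in> keys m")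
      case True
      then have "lookup m i \<le> (\<Sum>i\<in>keys m. lookup m i)"
        by (intro member_le_sum) auto
      then show ?thesis using m by (simp add: multi_indices_def mdeg_def)
    qed (simp add: in_keys_iff)
    moreover have "lookup m i = 0" if "i \<notin> {1..n}" for i
      using that m by (auto simp: multi_indices_def in_keys_iff)
    ultimately show "m \<in> lookup -` {f. \<forall>i. (i \<in> {1..n} \<longrightarrow> f i \<in> {0..e}) \<and> (i \<notin> {1..n} \<longrightarrow> f i = 0)}"
      by auto
  qed
  moreover have "finite {f :: nat \<Rightarrow> nat. \<forall>i. (i \<in> {1..n} \<longrightarrow> f i \<in> {0..e}) \<and> (i \<notin> {1..n} \<longrightarrow> f i = 0)}"
    by (rule finite_set_of_finite_funs) auto
  moreover have "inj (lookup :: nat mono \<Rightarrow> nat \<Rightarrow> nat)"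
    by (simp add: inj_def Poly_Mapping.lookup_inject)
  ultimately show ?thesis
    by (meson finite_subset finite_vimageI)
qed

lemma vars_add: "vars (p + q) \<subseteq> vars p \<union> vars q"
  using keys_add[of p q] by (fastforce simp: vars_def)

lemma vars_mult: "vars (p * q) \<subseteq> vars p \<union> vars q"
proof
  fix i assume "i \<in> vars (p * q)"
  then obtain m where m: "m \<in> keys (p * q)" "i \<in> keys m" by (auto simp: vars_def)
  then obtain a b where "m = a + b" "a \<in> keys p" "b \<in> keys q"
    using keys_mult[of p q] by blast
  with m keys_add[of a b] show "i \<in> vars p \<union> vars q"
    by (fastforce simp: vars_def)
qed

(* Hence the ideals Idl are taken in an actual ring. *)
lemma cring_poly_ring: "cring (poly_ring n :: (nat, 'k::comm_ring_1) mpoly ring)"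
proof (rule cringI)
  show "abelian_group (poly_ring n :: (nat, 'k) mpoly ring)"
  proof (rule abelian_groupI)
    fix x :: "(nat, 'k) mpoly" assume "x \<in> carrier (poly_ring n)"
    then show "\<exists>y\<in>carrier (poly_ring n). y \<oplus>\<^bsub>poly_ring n\<^esub> x = \<zero>\<^bsub>poly_ring n\<^esub>"
      by (intro bexI[of _ "- x"]) (auto simp: poly_ring_def vars_def)
  qed (use vars_add in \<open>fastforce simp: poly_ring_def vars_def add_ac\<close>)+
  show "comm_monoid (poly_ring n :: (nat, 'k) mpoly ring)"
    by (rule comm_monoidI)
       (use vars_mult in \<open>fastforce simp: poly_ring_def vars_def mult_ac\<close>)+
qed (simp add: poly_ring_def distrib_right)

end

theory Submission
  imports Defs "Jordan_Normal_Form.Determinant"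
begin

text \<open>For \<open>G\<close> of degree \<open>e\<close> and \<open>2 * c \<le> e\<close> consider the symmetric matrix
  \<open>A c\<close> with rows and columns indexed by the monomials of degree \<open>c\<close>, whose entry at
  \<open>(m, m')\<close> is \<open>(m * m' * x_n^(e - 2 * c)) \<circ> G\<close>.  Suppose that all these matrices are
  invertible, and call a monomial \<open>x_n^j * x^b\<close> (with \<open>x_n\<close> not occurring in \<open>x^b\<close>)
  standard if \<open>j + 2 * \<bar>b\<bar> \<le> e\<close>.  If \<open>f \<in> Ann G\<close> had a standard leading monomial
  \<open>x_n^j * x^b\<close>, then \<open>x_n^j\<close> would divide the leading form of \<open>f\<close>, and the quotient would
  give a kernel vector of \<open>A \<bar>b\<bar>\<close>.  Conversely, for a nonstandard monomial \<open>l\<close> of degree at most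
  \<open>e\<close>, solving a linear system with matrix \<open>A c\<close>, \<open>c = e - deg l\<close>, yields a form \<open>g\<close> with
  \<open>l - x_n^(e - 2 * c) * g \<in> Ann G\<close>, and \<open>l\<close> is its leading monomial; monomials of degree above \<open>e\<close>
  annihilate \<open>G\<close> anyway.  So the initial ideal is
  spanned by the nonstandard monomials.

  For \<open>G = H_e\<close> the matrices are \<open>(m + m' + q)!\<close>, the moments of a product of Laguerre weights.
  They are positive definite over the reals, so their integer determinants are nonzero, which shows
  that the product of the determinants is not the zero polynomial in the coefficients of \<open>G\<close>.
  Finally \<open>\<phi> f \<circ> H_e\<close> collects the divided derivatives of \<open>x^s * f\<close> at \<open>(1, \<dots>, 1)\<close>,
  where \<open>F_a\<close> vanishes to order \<open>\<bar>a\<bar>\<close>; therefore the polynomials \<open>\<phi> (x_n^j * F_a)\<close> with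
  \<open>j + 2 * \<bar>a\<bar> > e\<close> annihilate \<open>H_e\<close>, and their leading monomials \<open>x_n^j * x^a\<close> include the
  minimal nonstandard ones.\<close>

section \<open>Monomials and differentiation\<close>

lemma mdeg_superset:
  assumes "finite A" "keys m \<subseteq> A"
  shows "mdeg m = (\<Sum>i\<in>A. lookup m i)"
  unfolding mdeg_def using assms by (intro sum.mono_neutral_left) (auto simp: in_keys_iff)

lemma mdeg_add: "mdeg (s + t) = mdeg s + mdeg t"
proof -
  let ?A = "keys s \<union> keys t"
  have "mdeg (s + t) = (\<Sum>i\<in>?A. lookup (s + t) i)"
    using keys_add[of s t] by (intro mdeg_superset) auto
  also have "\<dots> = (\<Sum>i\<in>?A. lookup s i) + (\<Sum>i\<in>?A. lookup t i)"
    by (simp add: lookup_add sum.distrib)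
  also have "(\<Sum>i\<in>?A. lookup s i) = mdeg s" by (intro mdeg_superset[symmetric]) auto
  also have "(\<Sum>i\<in>?A. lookup t i) = mdeg t" by (intro mdeg_superset[symmetric]) auto
  finally show ?thesis .
qed

lemma mdeg_single [simp]: "mdeg (Poly_Mapping.single i r) = r"
  by (simp add: mdeg_def)

lemma mdeg_zero [simp]: "mdeg 0 = 0"
  by (simp add: mdeg_def)

lemma mdeg_eq_0_iff: "mdeg m = 0 \<longleftrightarrow> m = 0"
proof
  assume "mdeg m = 0"
  then have "lookup m i = 0" for i
    by (cases "i \<in> keys m") (auto simp: mdeg_def not_in_keys_iff_lookup_eq_zero)
  then show "m = 0" by (intro poly_mapping_eqI) simp
qed simp

lemma keys_mono_add: "keys (s + t :: 'v mono) = keys s \<union> keys t"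
  by (auto simp: in_keys_iff lookup_add)

lemma mono_minus_add_single:
  "lookup m i > 0 \<Longrightarrow> (m - Poly_Mapping.single i 1) + Poly_Mapping.single i 1 = (m :: 'v mono)"
  by (rule poly_mapping_eqI) (auto simp: lookup_add lookup_minus lookup_single when_def)

lemma mono_diff_add:
  "(\<And>i. lookup s i \<le> lookup t i) \<Longrightarrow> (t - s) + s = (t :: 'v mono)"
  by (rule poly_mapping_eqI) (simp add: lookup_add lookup_minus)

lemma mono_le_mdeg_eq:
  assumes "\<And>i. lookup s i \<le> lookup t i" and "mdeg s = mdeg (t :: 'v mono)"
  shows "s = t"
proof -
  have "mdeg ((t - s) + s) = mdeg t" using mono_diff_add[of s t] assms(1) by simp
  then have "t - s = 0" using assms(2) by (simp add: mdeg_add mdeg_eq_0_iff)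
  then show ?thesis using mono_diff_add[of s t] assms(1) by simp
qed

lemma ex_sub_multi_index:
  assumes "c \<le> mdeg (b :: 'v mono)"
  obtains b' where "\<And>i. lookup b' i \<le> lookup b i" "mdeg b' = c"
proof -
  have "\<exists>b'. (\<forall>i. lookup b' i \<le> lookup b i) \<and> mdeg b' = c"
    using assms
  proof (induction rule: inc_induct)
    case base
    then show ?case by auto
  next
    case (step c)
    then obtain b' where b': "\<forall>i. lookup b' i \<le> lookup b i" "mdeg b' = Suc c" by auto
    then have "b' \<noteq> 0" by auto
    then obtain i where i: "lookup b' i > 0" by (auto simp: poly_mapping_eq_iff fun_eq_iff)
    have "mdeg (b' - Poly_Mapping.single i 1) = c"
      using mdeg_add[of "b' - Poly_Mapping.single i 1" "Poly_Mapping.single i 1"]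
        mono_minus_add_single[OF i] b'(2) by simp
    then show ?case using b'(1)
      by (intro exI[of _ "b' - Poly_Mapping.single i 1"])
        (auto simp: lookup_minus intro: order_trans[OF diff_le_self])
  qed
  then show thesis using that by blast
qed

section \<open>Factorials of multi-indices and linear functionals on polynomials\<close>

definition mfact :: "'v mono \<Rightarrow> nat" where
  "mfact m = (\<Prod>i\<in>keys m. fact (lookup m i))"

lemma mfact_superset:
  assumes "finite A" "keys m \<subseteq> A"
  shows "mfact m = (\<Prod>i\<in>A. fact (lookup m i))"
  unfolding mfact_def using assms by (intro prod.mono_neutral_left) (auto simp: in_keys_iff)

lemma mfact_pos [simp]: "mfact m > 0"
  by (simp add: mfact_def prod_pos)

lemma mfact_neq_0 [simp]: "mfact m \<noteq> 0"
  using mfact_pos[of m] by simp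

lemma mfact_nonzero [simp]: "(of_nat (mfact m) :: 'k::field_char_0) \<noteq> 0"
  using mfact_pos[of m] by (metis of_nat_eq_0_iff less_irrefl)

lemma mfact_add_single: "mfact (m + Poly_Mapping.single i 1) = Suc (lookup m i) * mfact m"
proof -
  let ?A = "insert i (keys m)"
  have "mfact (m + Poly_Mapping.single i 1) = (\<Prod>j\<in>?A. fact (lookup (m + Poly_Mapping.single i 1) j))"
    by (intro mfact_superset) (auto simp: keys_mono_add)
  also have "\<dots> = fact (Suc (lookup m i)) * (\<Prod>j\<in>?A - {i}. fact (lookup m j))"
  proof -
    have "(\<Prod>j\<in>?A - {i}. fact (lookup (m + Poly_Mapping.single i 1) j)) = (\<Prod>j\<in>?A - {i}. fact (lookup m j))"
      by (rule prod.cong) (auto simp: lookup_add lookup_single when_def)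
    then show ?thesis by (subst prod.remove[of _ i]) (auto simp: lookup_add)
  qed
  also have "\<dots> = Suc (lookup m i) * (\<Prod>j\<in>?A. fact (lookup m j))"
    by (subst (2) prod.remove[of _ i]) (auto simp: algebra_simps)
  also have "(\<Prod>j\<in>?A. fact (lookup m j)) = mfact m"
    by (intro mfact_superset[symmetric]) auto
  finally show ?thesis .
qed

text \<open>One functional serves for the action \<open>act\<close>, the divided derivatives at (1,
  ..., 1) and the evaluation \<open>poly_eval\<close>; only the values on monomials differ.\<close>

definition lin_ext :: "('v mono \<Rightarrow> 'k) \<Rightarrow> ('v, 'k::comm_ring_1) mpoly \<Rightarrow> 'k" where
  "lin_ext g p = (\<Sum>m\<in>keys p. lookup p m * g m)"

lemma lin_ext_superset:
  assumes "finite A" "keys p \<subseteq> A"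
  shows "lin_ext g p = (\<Sum>m\<in>A. lookup p m * g m)"
  unfolding lin_ext_def using assms by (intro sum.mono_neutral_left) (auto simp: in_keys_iff)

lemma lin_ext_zero [simp]: "lin_ext g 0 = 0"
  by (simp add: lin_ext_def)

lemma lin_ext_single [simp]: "lin_ext g (Poly_Mapping.single m c) = c * g m"
  by (simp add: lin_ext_def)

lemma lin_ext_add: "lin_ext g (p + q) = lin_ext g p + lin_ext g q"
proof -
  let ?A = "keys p \<union> keys q"
  have "lin_ext g (p + q) = (\<Sum>m\<in>?A. lookup (p + q) m * g m)"
    using keys_add[of p q] by (intro lin_ext_superset) auto
  also have "\<dots> = (\<Sum>m\<in>?A. lookup p m * g m) + (\<Sum>m\<in>?A. lookup q m * g m)"
    by (simp add: lookup_add sum.distrib distrib_right)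
  also have "(\<Sum>m\<in>?A. lookup p m * g m) = lin_ext g p" by (intro lin_ext_superset[symmetric]) auto
  also have "(\<Sum>m\<in>?A. lookup q m * g m) = lin_ext g q" by (intro lin_ext_superset[symmetric]) auto
  finally show ?thesis .
qed

lemma lin_ext_uminus: "lin_ext g (- p) = - lin_ext g p"
  using lin_ext_add[of g p "- p"] by (simp add: minus_unique)

lemma lin_ext_diff: "lin_ext g (p - q) = lin_ext g p - lin_ext g q"
  using lin_ext_add[of g p "- q"] by (simp add: lin_ext_uminus)

lemma lin_ext_sum: "lin_ext g (sum f A) = (\<Sum>x\<in>A. lin_ext g (f x))"
  by (induction A rule: infinite_finite_induct) (auto simp: lin_ext_add)

lemma poly_mapping_sum_single:
  "p = (\<Sum>m\<in>keys p. Poly_Mapping.single m (lookup p m))"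
  by (rule poly_mapping_eqI)
    (auto simp: lookup_sum lookup_single when_def in_keys_iff sum.delta')

lemma lin_ext_mult:
  "lin_ext g (p * q) = (\<Sum>m\<in>keys p. \<Sum>m'\<in>keys q. lookup p m * lookup q m' * g (m + m'))"
proof -
  have "p * q = (\<Sum>m\<in>keys p. \<Sum>m'\<in>keys q. Poly_Mapping.single (m + m') (lookup p m * lookup q m'))"
    using arg_cong2[OF poly_mapping_sum_single[of p] poly_mapping_sum_single[of q], of "(*)"]
    by (simp only: sum_product mult_single)
  then show ?thesis by (simp add: lin_ext_sum)
qed

lemma lin_ext_Var_mult: "lin_ext g (Var i * p) = lin_ext (\<lambda>m. g (m + Poly_Mapping.single i 1)) p"
  by (simp add: lin_ext_mult Var_def) (simp add: lin_ext_def add.commute)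

text \<open>Multiplying the coefficient at \<open>s\<close> by \<open>s!\<close> turns differentiation into a shift of the index.\<close>

definition dcoeff :: "('v, 'k::comm_ring_1) mpoly \<Rightarrow> 'v mono \<Rightarrow> 'k" where
  "dcoeff g s = of_nat (mfact s) * lookup g s"

lemma lookup_partial:
  "lookup (partial i g) s = of_nat (Suc (lookup s i)) * lookup g (s + Poly_Mapping.single i 1)"
proof -
  let ?x = "Poly_Mapping.single i (1::nat)"
  have "lookup (partial i g) s
      = (\<Sum>m\<in>keys g. of_nat (lookup m i) * lookup g m when m - ?x = s)"
    by (simp add: partial_def lookup_sum lookup_single)
  also have "\<dots> = (\<Sum>m\<in>keys g. if m = s + ?x then of_nat (lookup m i) * lookup g m else 0)"
  proof (rule sum.cong[OF refl])
    fix m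
    show "(of_nat (lookup m i) * lookup g m when m - ?x = s)
        = (if m = s + ?x then of_nat (lookup m i) * lookup g m else 0)"
    \<comment> \<open>Truncated subtraction can give \<open>m - ?x = s\<close> without
      \<open>m = s + ?x\<close>, but only if \<open>x_i\<close> does not occur in \<open>m\<close>,
      and then the coefficient is 0.\<close>
    proof (cases "lookup m i = 0")
      case False
      then have "m - ?x = s \<longleftrightarrow> m = s + ?x" using mono_minus_add_single[of m i] by auto
      then show ?thesis by (simp add: when_def)
    qed (auto simp: lookup_add)
  qed
  also have "\<dots> = of_nat (Suc (lookup s i)) * lookup g (s + ?x)"
    by (auto simp: sum.delta' in_keys_iff lookup_add)
  finally show ?thesis .
qed

lemma dcoeff_partial: "dcoeff (partial i g) s = dcoeff g (s + Poly_Mapping.single i 1)"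
  by (simp only: dcoeff_def lookup_partial mfact_add_single of_nat_mult mult_ac)

lemma dcoeff_partial_power:
  "dcoeff ((partial i ^^ r) g) s = dcoeff g (s + Poly_Mapping.single i r)"
proof (induction r arbitrary: s)
  case (Suc r)
  then show ?case by (simp add: dcoeff_partial add.assoc flip: single_add)
qed simp

lemma dcoeff_mono_act: "dcoeff (mono_act m g) s = dcoeff g (m + s)"
proof -
  have "dcoeff (foldr (\<lambda>i. partial i ^^ lookup m i) xs g) s
      = dcoeff g (s + (\<Sum>i\<leftarrow>xs. Poly_Mapping.single i (lookup m i)))" for xs
    by (induction xs arbitrary: s) (simp_all add: dcoeff_partial_power add_ac)
  moreover have "(\<Sum>i\<leftarrow>sorted_list_of_set (keys m). Poly_Mapping.single i (lookup m i)) = m"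
    by (simp add: sum_list_distinct_conv_sum_set flip: poly_mapping_sum_single)
  ultimately show ?thesis by (simp add: mono_act_def add.commute)
qed

lemma lookup_const_mult: "lookup (Poly_Mapping.single 0 c * p) s = c * lookup p s"
  by (simp flip: mult_map_scale_conv_mult add: Poly_Mapping.map.rep_eq when_def)

lemma dcoeff_act: "dcoeff (act f g) s = lin_ext (\<lambda>m. dcoeff g (m + s)) f"
proof -
  have "dcoeff (act f g) s = (\<Sum>m\<in>keys f. lookup f m * dcoeff (mono_act m g) s)"
    by (simp add: act_def dcoeff_def lookup_sum lookup_const_mult sum_distrib_left mult.left_commute)
  then show ?thesis by (simp add: dcoeff_mono_act lin_ext_def)
qed

text \<open>In characteristic zero the factors \<open>s!\<close> are invertible, so annihilating
  \<open>g\<close> becomes a system of linear equations in the coefficients of \<open>f\<close>, one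
  for each monomial \<open>s\<close>.\<close>

lemma act_eq_0_iff:
  fixes g :: "(nat, 'k::field_char_0) mpoly"
  shows "act f g = 0 \<longleftrightarrow> (\<forall>s. lin_ext (\<lambda>m. dcoeff g (m + s)) f = 0)"
proof -
  have "act f g = 0 \<longleftrightarrow> (\<forall>s. dcoeff (act f g) s = 0)"
    by (simp add: dcoeff_def poly_mapping_eq_iff fun_eq_iff)
  then show ?thesis by (simp add: dcoeff_act)
qed

section \<open>Degree reverse lexicographic order and monomial ideals\<close>

lemma drl_less_irrefl: "\<not> drl_less s s"
  by (auto simp: drl_less_def)

lemma drl_less_trans:
  assumes "drl_less s t" "drl_less t u"
  shows "drl_less s u"
proof (cases "mdeg s = mdeg t \<and> mdeg t = mdeg u")
  case True
  with assms obtain i i' where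
    i: "lookup t i < lookup s i" "\<forall>j>i. lookup s j = lookup t j" and
    i': "lookup u i' < lookup t i'" "\<forall>j>i'. lookup t j = lookup u j"
    unfolding drl_less_def by auto
  have "lookup u (max i i') < lookup s (max i i')"
    using i i' by (cases i i' rule: linorder_cases) (auto simp: max_def)
  moreover have "\<forall>j>max i i'. lookup s j = lookup u j" using i i' by auto
  ultimately show ?thesis using True unfolding drl_less_def by auto
qed (use assms in \<open>auto simp: drl_less_def\<close>)

lemma drl_less_total:
  assumes "s \<noteq> t"
  shows "drl_less s t \<or> drl_less t s"
proof (cases "mdeg s = mdeg t")
  case True
  let ?D = "{i. lookup s i \<noteq> lookup t i}"
  have fin: "finite ?D"
    by (rule finite_subset[of _ "keys s \<union> keys t"]) (auto simp: in_keys_iff)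
  have "?D \<noteq> {}" using assms by (auto simp: poly_mapping_eq_iff fun_eq_iff)
  then have "Max ?D \<in> ?D" using fin by (rule Max_in[rotated])
  moreover have "lookup s j = lookup t j" if "j > Max ?D" for j
    using Max_ge[OF fin, of j] that by fastforce
  ultimately show ?thesis using True unfolding drl_less_def
    by (metis (mono_tags, lifting) linorder_neqE_nat mem_Collect_eq)
qed (auto simp: drl_less_def)

text \<open>Within one degree the exponent of \<open>x_n\<close> is compared first. Apart from being
  a strict total order, the order enters the later arguments only through this lemma and its
  consequence \<open>drl_less_last_le\<close>.\<close>

lemma drl_less_last:
  assumes "mdeg s = mdeg t" "keys s \<subseteq> {1..n}" "keys t \<subseteq> {1..n}" "lookup t n < lookup s n"
  shows "drl_less s t"
proof -
  have "lookup s j = lookup t j" if "j > n" for j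
    using assms(2,3) that by (metis atLeastAtMost_iff in_keys_iff leD subsetD)
  then show ?thesis using assms unfolding drl_less_def by auto
qed

lemma drl_less_last_le:
  assumes "drl_less s t" "mdeg s = mdeg t" "keys s \<subseteq> {1..n}" "keys t \<subseteq> {1..n}"
  shows "lookup t n \<le> lookup s n"
  using drl_less_last[of t s n] drl_less_trans[of s t s] drl_less_irrefl assms
  by (metis not_le)

lemma lead_mono_eqI:
  assumes "m \<in> keys f" "\<And>m'. m' \<in> keys f \<Longrightarrow> m' \<noteq> m \<Longrightarrow> drl_less m' m"
  shows "lead_mono f = m"
  unfolding lead_mono_def
proof (rule the_equality)
  fix l assume l: "l \<in> keys f \<and> (\<forall>m'\<in>keys f. m' \<noteq> l \<longrightarrow> drl_less m' l)"
  show "l = m"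
  proof (rule ccontr)
    assume "l \<noteq> m"
    then have "drl_less l m" "drl_less m l" using l assms by auto
    then show False using drl_less_trans drl_less_irrefl by blast
  qed
qed (use assms in auto)

lemma lead_mono:
  assumes "f \<noteq> 0"
  shows "lead_mono f \<in> keys f"
    and "m \<in> keys f \<Longrightarrow> m \<noteq> lead_mono f \<Longrightarrow> drl_less m (lead_mono f)"
proof -
  have "keys f \<noteq> {}" using assms by (metis keys_eq_empty)
  then obtain l where l: "l \<in> keys f" "\<forall>m\<in>keys f. m \<noteq> l \<longrightarrow> \<not> drl_less l m"
    using Finite_Set.bex_max_element[of "keys f" drl_less] drl_less_trans drl_less_irrefl
    by (metis finite_keys asymp_onI transp_onI)
  then have "\<And>m. m \<in> keys f \<Longrightarrow> m \<noteq> l \<Longrightarrow> drl_less m l" using drl_less_total by blast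
  moreover from this have "lead_mono f = l" using l by (intro lead_mono_eqI)
  ultimately show "lead_mono f \<in> keys f"
    and "m \<in> keys f \<Longrightarrow> m \<noteq> lead_mono f \<Longrightarrow> drl_less m (lead_mono f)"
    using l by auto
qed

section \<open>Ideals generated by monomials\<close>

lemma ring_poly_ring: "ring (poly_ring n :: (nat, 'k::comm_ring_1) mpoly ring)"
  by (rule cring.axioms(1)[OF cring_poly_ring])

lemma single_carrier_iff:
  "Poly_Mapping.single m (1 :: 'k::comm_ring_1) \<in> carrier (poly_ring n) \<longleftrightarrow> keys m \<subseteq> {1..n}"
  by (simp add: poly_ring_def vars_def)

lemma ideal_mono_ideal:
  assumes "\<forall>m\<in>M. keys m \<subseteq> {1..n}"
  shows "ideal (mono_ideal n M :: (nat, 'k::comm_ring_1) mpoly set) (poly_ring n)"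
  unfolding mono_ideal_def using assms
  by (intro ring.genideal_ideal[OF ring_poly_ring]) (auto simp: single_carrier_iff)

lemma single_in_mono_ideal:
  assumes "\<forall>m\<in>M. keys m \<subseteq> {1..n}" "m' \<in> M" "\<And>i. lookup m' i \<le> lookup m i" "keys m \<subseteq> {1..n}"
  shows "Poly_Mapping.single m (1 :: 'k::comm_ring_1) \<in> mono_ideal n M"
proof -
  let ?J = "mono_ideal n M :: (nat, 'k) mpoly set"
  have "Poly_Mapping.single m' (1 :: 'k) \<in> ?J"
    unfolding mono_ideal_def using assms(1,2)
    by (intro subsetD[OF ring.genideal_self[OF ring_poly_ring]]) (auto simp: single_carrier_iff)
  moreover have "Poly_Mapping.single (m - m') (1 :: 'k) \<in> carrier (poly_ring n)"
  proof -
    have "keys (m - m') \<subseteq> keys m" by (auto simp: in_keys_iff lookup_minus)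
    then show ?thesis using assms(4) by (auto simp: single_carrier_iff)
  qed
  ultimately have "Poly_Mapping.single (m - m') 1 \<otimes>\<^bsub>poly_ring n\<^esub> Poly_Mapping.single m' (1 :: 'k) \<in> ?J"
    by (rule ideal.I_l_closed[OF ideal_mono_ideal[OF assms(1)]])
  then show ?thesis using mono_diff_add[of m' m] assms(3)
    by (simp add: poly_ring_def mult_single)
qed

lemma mono_ideal_subset:
  assumes "\<forall>m\<in>M. keys m \<subseteq> {1..n}" "\<forall>m\<in>N. keys m \<subseteq> {1..n}"
    and "\<And>m. m \<in> M \<Longrightarrow> \<exists>m'\<in>N. \<forall>i. lookup m' i \<le> lookup m i"
  shows "(mono_ideal n M :: (nat, 'k::comm_ring_1) mpoly set) \<subseteq> mono_ideal n N"
  unfolding mono_ideal_def[of n M]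
proof (rule ring.genideal_minimal[OF ring_poly_ring ideal_mono_ideal[OF assms(2)]])
  show "(\<lambda>m. Poly_Mapping.single m 1) ` M \<subseteq> (mono_ideal n N :: (nat, 'k) mpoly set)"
    using assms single_in_mono_ideal by blast
qed

lemma a_inv_poly_ring:
  assumes "p \<in> carrier (poly_ring n :: (nat, 'k::comm_ring_1) mpoly ring)"
  shows "\<ominus>\<^bsub>poly_ring n\<^esub> p = - p"
proof -
  interpret cring "poly_ring n :: (nat, 'k) mpoly ring" by (rule cring_poly_ring)
  show ?thesis using assms by (intro minus_equality) (auto simp: poly_ring_def vars_def)
qed

text \<open>The polynomials all of whose monomials have a divisor in \<open>M\<close> form an ideal
  that contains the generators, hence contains \<open>mono_ideal n M\<close>.\<close>

lemma keys_mono_ideal: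
  assumes "\<forall>m\<in>M. keys m \<subseteq> {1..n}" "p \<in> (mono_ideal n M :: (nat, 'k::comm_ring_1) mpoly set)"
    and "l \<in> keys p"
  shows "\<exists>m\<in>M. \<forall>i. lookup m i \<le> lookup l i"
proof -
  let ?J = "{p \<in> carrier (poly_ring n :: (nat, 'k) mpoly ring).
    \<forall>l\<in>keys p. \<exists>m\<in>M. \<forall>i. lookup m i \<le> lookup l i}"
  interpret cring "poly_ring n :: (nat, 'k) mpoly ring" by (rule cring_poly_ring)
  have mult: "x \<otimes>\<^bsub>poly_ring n\<^esub> a \<in> ?J" if a: "a \<in> ?J" and x: "x \<in> carrier (poly_ring n)" for a x
  proof -
    have "\<exists>m\<in>M. \<forall>i. lookup m i \<le> lookup l i" if l: "l \<in> keys (x * a)" for l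
    proof -
      obtain u v where "l = u + v" "v \<in> keys a" using keys_mult[of x a] l by blast
      moreover from this obtain m where "m \<in> M" "\<forall>i. lookup m i \<le> lookup v i" using a by blast
      ultimately show ?thesis by (auto simp: lookup_add intro!: bexI[of _ m] trans_le_add2)
    qed
    then show ?thesis using m_closed[OF x, of a] a by (auto simp: poly_ring_def)
  qed
  have "ideal ?J (poly_ring n)"
  proof (rule idealI[OF ring_poly_ring])
    show "subgroup ?J (add_monoid (poly_ring n))"
    proof
      fix x y assume xy: "x \<in> ?J" "y \<in> ?J"
      then have "x \<oplus>\<^bsub>poly_ring n\<^esub> y \<in> carrier (poly_ring n)" by auto
      then show "x \<otimes>\<^bsub>add_monoid (poly_ring n)\<^esub> y \<in> ?J"
        using xy keys_add[of x y] by (fastforce simp: poly_ring_def)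
    next
      fix x assume x: "x \<in> ?J"
      then have inv: "inv\<^bsub>add_monoid (poly_ring n)\<^esub> x = - x"
        using a_inv_poly_ring[of x n] by (simp only: a_inv_def mem_Collect_eq)
      from x have "- x \<in> ?J" by (auto simp: poly_ring_def vars_def)
      then show "inv\<^bsub>add_monoid (poly_ring n)\<^esub> x \<in> ?J"
        by (simp only: inv)
    qed (auto simp: poly_ring_def vars_def)
  qed (use mult m_comm in auto)
  moreover have "(\<lambda>m. Poly_Mapping.single m 1) ` M \<subseteq> ?J"
    using assms(1) by (auto simp: single_carrier_iff)
  ultimately have "mono_ideal n M \<subseteq> ?J"
    unfolding mono_ideal_def by (rule genideal_minimal)
  then show ?thesis using assms(2,3) by blast
qed

text \<open>A monomial of \<open>M\<close> left out of \<open>N\<close> would, by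
  \<open>keys_mono_ideal\<close>, have a divisor in \<open>N\<close>, which the antichain condition
  forces to be that monomial itself.\<close>

lemma mono_ideal_antichain_minimal:
  assumes "\<forall>m\<in>M. keys m \<subseteq> {1..n}"
    and antichain: "\<And>m m'. m \<in> M \<Longrightarrow> m' \<in> M \<Longrightarrow> (\<forall>i. lookup m i \<le> lookup m' i) \<Longrightarrow> m = m'"
    and "N \<subset> M"
  shows "(mono_ideal n N :: (nat, 'k::comm_ring_1) mpoly set) \<noteq> mono_ideal n M"
proof
  assume eq: "(mono_ideal n N :: (nat, 'k) mpoly set) = mono_ideal n M"
  obtain m where m: "m \<in> M" "m \<notin> N" using assms(3) by blast
  have N: "\<forall>m\<in>N. keys m \<subseteq> {1..n}" using assms(1,3) by blast
  have "Poly_Mapping.single m (1 :: 'k) \<in> mono_ideal n N"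
    unfolding eq using assms(1) m by (intro single_in_mono_ideal[of M n m]) auto
  from keys_mono_ideal[OF N this, of m] obtain m' where "m' \<in> N" "\<forall>i. lookup m' i \<le> lookup m i"
    by auto
  then show False using antichain[of m' m] m assms(3) by blast
qed

section \<open>The polynomials F\<close>

lemma lookup_phi: "lookup (phi f) m = lookup f m / of_nat (mfact m)"
  by (auto simp: phi_def mfact_def lookup_sum lookup_single when_def in_keys_iff sum.delta')

lemma keys_phi [simp]: "keys (phi f) = keys f"
  by (auto simp: in_keys_iff lookup_phi)

lemma lin_ext_phi: "lin_ext g (phi f) = lin_ext (\<lambda>m. g m / of_nat (mfact m)) f"
  by (simp add: lin_ext_def lookup_phi)

lemma mono_induct [consumes 1, case_names zero add]:
  assumes "keys (a :: 'v mono) \<subseteq> A" "P 0"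
    and add: "\<And>a i. keys a \<subseteq> A \<Longrightarrow> i \<in> A \<Longrightarrow> P a \<Longrightarrow> P (a + Poly_Mapping.single i 1)"
  shows "P a"
  using assms(1)
proof (induction "mdeg a" arbitrary: a)
  case 0
  then show ?case using assms(2) by (simp add: mdeg_eq_0_iff)
next
  case (Suc k)
  then have "a \<noteq> 0" by auto
  then obtain i where i: "lookup a i > 0" by (auto simp: poly_mapping_eq_iff fun_eq_iff)
  let ?b = "a - Poly_Mapping.single i 1"
  have b: "?b + Poly_Mapping.single i 1 = a" using i by (rule mono_minus_add_single)
  have "mdeg a = Suc (mdeg ?b)" using mdeg_add[of ?b "Poly_Mapping.single i 1"] b by simp
  moreover have "keys ?b \<subseteq> A" using Suc.prems b keys_mono_add[of ?b] by (metis le_sup_iff)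
  ultimately have "P ?b" using Suc by simp
  moreover have "i \<in> A" using i Suc.prems by (auto simp: in_keys_iff)
  ultimately show ?case using add[of ?b i] \<open>keys ?b \<subseteq> A\<close> b by simp
qed

lemma F_zero [simp]: "F n 0 = 1"
  by (simp add: F_def)

lemma F_add_single:
  assumes "i \<in> {1..n - 1}"
  shows "F n (a + Poly_Mapping.single i 1) = (Var i - Var n) * (F n a :: (nat, 'k::comm_ring_1) mpoly)"
proof -
  let ?F = "F n :: nat mono \<Rightarrow> (nat, 'k) mpoly"
  have "?F (Poly_Mapping.single i 1) = (\<Prod>j\<in>{1..n - 1}. if j = i then Var i - Var n else 1)"
    unfolding F_def by (rule prod.cong) (auto simp: lookup_single when_def)
  also have "\<dots> = Var i - Var n" using assms by (subst prod.delta) auto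
  finally have "?F (Poly_Mapping.single i 1) = Var i - Var n" .
  moreover have "?F (a + Poly_Mapping.single i 1) = ?F a * ?F (Poly_Mapping.single i 1)"
    by (simp add: F_def lookup_add power_add prod.distrib)
  ultimately show ?thesis by (simp only: mult.commute)
qed

lemma forms_mult: "p \<in> forms n a \<Longrightarrow> q \<in> forms n b \<Longrightarrow> p * q \<in> forms n (a + b)"
  using keys_mult[of p q]
  by (fastforce simp: forms_def multi_indices_def mdeg_add keys_mono_add)

lemma Var_forms: "i \<in> {1..n} \<Longrightarrow> (Var i :: (nat, 'k::comm_ring_1) mpoly) \<in> forms n 1"
  by (simp add: forms_def Var_def multi_indices_def)

lemma one_forms: "1 \<in> forms n 0"
  by (simp add: forms_def multi_indices_def)

lemma Var_power_forms:
  "i \<in> {1..n} \<Longrightarrow> (Var i ^ j :: (nat, 'k::comm_ring_1) mpoly) \<in> forms n j"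
proof (induction j)
  case (Suc j)
  then show ?case using forms_mult[OF Var_forms[of i n] Suc.IH] by simp
qed (simp add: one_forms)

lemma F_forms:
  assumes "keys a \<subseteq> {1..n - 1}"
  shows "(F n a :: (nat, 'k::comm_ring_1) mpoly) \<in> forms n (mdeg a)"
  using assms
proof (induction a rule: mono_induct)
  case (add a i)
  then have "i \<in> {1..n}" "n \<in> {1..n}" by auto
  then have "(Var i :: (nat, 'k) mpoly) \<in> forms n 1" "(Var n :: (nat, 'k) mpoly) \<in> forms n 1"
    using Var_forms by blast+
  then have "(Var i - Var n :: (nat, 'k) mpoly) \<in> forms n 1"
    using keys_diff[of "Var i :: (nat, 'k) mpoly" "Var n"] by (auto simp: forms_def)
  from forms_mult[OF this add.IH] show ?case
    by (simp only: F_add_single[OF add.hyps(2)] mdeg_add mdeg_single add.commute)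
qed (simp add: one_forms)

lemma Var_power: "Var i ^ j = Poly_Mapping.single (Poly_Mapping.single i j) (1 :: 'k::comm_ring_1)"
  by (induction j) (simp_all add: Var_def mult_single flip: single_add)

text \<open>Modulo \<open>x_n\<close> each factor \<open>x_i - x_n\<close> becomes
  \<open>x_i\<close>.\<close>

lemma F_eq_leading_plus:
  assumes "keys a \<subseteq> {1..n - 1}"
  shows "\<exists>r. F n a = Poly_Mapping.single a (1 :: 'k::comm_ring_1) + Var n * r"
  using assms
proof (induction a rule: mono_induct)
  case zero
  show ?case by (intro exI[of _ 0]) simp
next
  case (add a i)
  then obtain r where r: "F n a = Poly_Mapping.single a (1 :: 'k) + Var n * r" by blast
  have "Var i * Poly_Mapping.single a (1 :: 'k) = Poly_Mapping.single (a + Poly_Mapping.single i 1) 1"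
    by (simp add: Var_def mult_single add.commute)
  then have "F n (a + Poly_Mapping.single i 1) = Poly_Mapping.single (a + Poly_Mapping.single i 1) 1
      + Var n * (Var i * r - Poly_Mapping.single a (1 :: 'k) - Var n * r)"
    unfolding F_add_single[OF add.hyps(2)] r by (simp add: algebra_simps)
  then show ?case by blast
qed

text \<open>By \<open>F_eq_leading_plus\<close> every other monomial of the form \<open>p\<close>
  contains \<open>x_n\<close> to a power above \<open>j\<close> and is therefore smaller;
  \<open>phi\<close> does not change the set of monomials.\<close>

lemma lead_mono_phi_F:
  fixes j :: nat
  assumes n: "n \<ge> 1" and a: "keys a \<subseteq> {1..n - 1}"
  defines "p \<equiv> Var n ^ j * F n a :: (nat, 'k::field_char_0) mpoly"
    and "l \<equiv> a + Poly_Mapping.single n j"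
  shows "l \<in> keys p" and "lead_mono (phi p) = l"
proof -
  have an: "lookup a n = 0" using a n by (force simp: in_keys_iff)
  obtain r where r: "F n a = Poly_Mapping.single a (1 :: 'k) + Var n * r"
    using F_eq_leading_plus[OF a] by blast
  define q where "q = Poly_Mapping.single (Poly_Mapping.single n (Suc j)) (1 :: 'k) * r"
  have "p = Poly_Mapping.single l 1 + Var n ^ Suc j * r"
    by (simp add: p_def l_def r distrib_left mult.assoc) (simp add: Var_power mult_single add.commute mult_ac)
  then have p: "p = Poly_Mapping.single l 1 + q" by (simp only: q_def Var_power)
  have q: "lookup m n > j" if "m \<in> keys q" for m
    using keys_mult[of "Poly_Mapping.single (Poly_Mapping.single n (Suc j)) (1 :: 'k)" r] that
    by (auto simp: q_def lookup_add)
  have ln: "lookup l n = j" by (simp add: l_def lookup_add an)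
  have "lookup q l = 0" using q[of l] ln by (auto simp: in_keys_iff)
  then show l: "l \<in> keys p" by (simp add: p in_keys_iff lookup_add)
  have pf: "keys p \<subseteq> multi_indices n (j + mdeg a)"
    using forms_mult[OF Var_power_forms F_forms[OF a], of n j] n by (auto simp: p_def forms_def)
  show "lead_mono (phi p) = l"
  proof (rule lead_mono_eqI)
    fix m assume m: "m \<in> keys (phi p)" "m \<noteq> l"
    then have "m \<in> keys q" using keys_add[of "Poly_Mapping.single l 1" q] by (auto simp: p)
    moreover have "m \<in> multi_indices n (j + mdeg a)" "l \<in> multi_indices n (j + mdeg a)"
      using pf l m by auto
    ultimately show "drl_less m l"
      using q[of m] ln by (intro drl_less_last[of _ _ n]) (auto simp: multi_indices_def)
  qed (use l in simp)
qed

section \<open>Vanishing of divided derivatives\<close>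

text \<open>The functional \<open>lin_ext (\<lambda>m. mbinom m s)\<close> is the divided derivative of \<open>x^s * f\<close> at
  \<open>(1, \<dots>, 1)\<close>.\<close>

definition mbinom :: "'v mono \<Rightarrow> 'v mono \<Rightarrow> 'k::field_char_0" where
  "mbinom m s = of_nat (mfact (m + s)) / (of_nat (mfact m) * of_nat (mfact s))"

text \<open>Pascal's rule in the coordinate \<open>i\<close>: \<open>mbinom m s\<close> is the
  product of the binomial coefficients of \<open>m_i + s_i\<close> over \<open>s_i\<close>, and the
  other factors stay fixed. If \<open>s_i = 0\<close>, the factor of this coordinate is 1 on both
  sides.\<close>

lemma mbinom_add_single:
  fixes m s :: "'v mono" and i :: 'v
  defines "x \<equiv> Poly_Mapping.single i 1"
  shows "(mbinom (m + x) s :: 'k::field_char_0) = mbinom m s + (if lookup s i = 0 then 0 else mbinom (m + x) (s - x))"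
proof -
  have ms: "mfact ((m + x) + s) = Suc (lookup m i + lookup s i) * mfact (m + s)"
    using mfact_add_single[of "m + s" i] by (simp add: x_def add_ac lookup_add)
  have mx: "mfact (m + x) = Suc (lookup m i) * mfact m"
    unfolding x_def by (rule mfact_add_single)
  \<comment> \<open>To be used with \<open>A = m_i + 1\<close>, \<open>B = s_i\<close>,
    \<open>P = (m + s)!\<close>, \<open>M = m!\<close> and \<open>S = (s - x)!\<close>.\<close>
  have id: "((A + B) * P) / ((A * M) * (B * S)) = P / (M * (B * S)) + P / ((A * M) * S)"
    if "A \<noteq> 0" "B \<noteq> 0" "M \<noteq> 0" "S \<noteq> 0" for A B P M S :: 'k
    using that by (simp add: field_simps)
  show ?thesis
  proof (cases "lookup s i = 0")
    case True
    then show ?thesis unfolding mbinom_def ms mx by (simp del: mult_Suc of_nat_Suc)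
  next
    case False
    then have sx: "s - x + x = s" by (simp add: x_def mono_minus_add_single[of s i, simplified])
    have "mfact s = lookup s i * mfact (s - x)"
      using mfact_add_single[of "s - x" i] sx False by (simp add: x_def lookup_minus)
    moreover have "(m + x) + (s - x) = m + s" using sx by (metis add.assoc add.commute)
    moreover have "of_nat (Suc (lookup m i + lookup s i)) = of_nat (Suc (lookup m i)) + (of_nat (lookup s i) :: 'k)"
      by simp
    ultimately show ?thesis using False unfolding mbinom_def ms mx
      by (simp add: id[of "of_nat (Suc (lookup m i))"] del: mult_Suc of_nat_Suc)
  qed
qed

lemma lin_ext_fun_add: "lin_ext (\<lambda>m. g m + h m) p = lin_ext g p + lin_ext h p"
  by (simp add: lin_ext_def distrib_left sum.distrib)

text \<open>Pascal's rule summed over \<open>p\<close>: modulo functionals of order one less,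
  multiplying by a variable has no effect, as is expected at the point (1, ..., 1).\<close>

lemma lin_ext_mbinom_Var_mult:
  fixes p :: "('v, 'k::field_char_0) mpoly"
  shows "lin_ext (\<lambda>m. mbinom m s) (Var i * p) = lin_ext (\<lambda>m. mbinom m s) p
    + (if lookup s i = 0 then 0 else lin_ext (\<lambda>m. mbinom m (s - Poly_Mapping.single i 1)) (Var i * p))"
proof -
  let ?x = "Poly_Mapping.single i 1"
  have "(\<lambda>m. mbinom (m + ?x) s :: 'k)
      = (\<lambda>m. mbinom m s + (if lookup s i = 0 then 0 else mbinom (m + ?x) (s - ?x)))"
    by (intro ext mbinom_add_single)
  then have "lin_ext (\<lambda>m. mbinom (m + ?x) s) p = lin_ext (\<lambda>m. mbinom m s) p
      + lin_ext (\<lambda>m. if lookup s i = 0 then 0 else mbinom (m + ?x) (s - ?x)) p"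
    by (simp only: lin_ext_fun_add)
  then show ?thesis
    by (cases "lookup s i = 0") (simp_all add: lin_ext_Var_mult, simp add: lin_ext_def)
qed

text \<open>Induction on \<open>a\<close>: the corrections in \<open>lin_ext_mbinom_Var_mult\<close>
  have order below \<open>mdeg a\<close> and vanish by the induction hypothesis, the variable being
  absorbed in \<open>p\<close>. So \<open>x_i\<close> and \<open>x_n\<close> act alike, and the new
  factor \<open>x_i - x_n\<close> gives 0.\<close>

lemma lin_ext_mbinom_F:
  fixes p :: "(nat, 'k::field_char_0) mpoly"
  assumes "keys a \<subseteq> {1..n - 1}" "mdeg s < mdeg a"
  shows "lin_ext (\<lambda>m. mbinom m s) (F n a * p) = 0"
  using assms
proof (induction a arbitrary: s p rule: mono_induct)
  case (add a i)
  have step: "(if lookup s j = 0 then 0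
      else lin_ext (\<lambda>m. mbinom m (s - Poly_Mapping.single j 1)) (Var j * (F n a * p))) = 0" for j
  proof (cases "lookup s j = 0")
    case False
    then have "s - Poly_Mapping.single j 1 + Poly_Mapping.single j 1 = s"
      by (simp add: mono_minus_add_single[of s j, simplified])
    then have "Suc (mdeg (s - Poly_Mapping.single j 1)) = mdeg s"
      using mdeg_add[of "s - Poly_Mapping.single j 1" "Poly_Mapping.single j 1"] by simp
    then have "mdeg (s - Poly_Mapping.single j 1) < mdeg a" using add.prems by (simp add: mdeg_add)
    from add.IH[OF this, of "Var j * p"] show ?thesis by (simp add: mult.left_commute)
  qed simp
  have "lin_ext (\<lambda>m. mbinom m s) (Var j * (F n a * p)) = lin_ext (\<lambda>m. mbinom m s) (F n a * p)" for j
    by (subst lin_ext_mbinom_Var_mult, subst step) simp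
  then show ?case
    by (simp add: F_add_single[OF add.hyps(2), simplified] left_diff_distrib lin_ext_diff mult.assoc)
qed simp

section \<open>Elements of the annihilator of \<open>H_e\<close>\<close>

lemma dcoeff_complete_sym:
  "dcoeff (complete_sym n e) s = (if s \<in> multi_indices n e then of_nat (mfact s) else 0)"
  by (auto simp: dcoeff_def complete_sym_def lookup_sum lookup_single when_def sum.delta'
      finite_multi_indices)

text \<open>Because \<open>(m + s)! / m! = s! * mbinom m s\<close>, the division in
  \<open>phi\<close> leaves \<open>s!\<close> times a divided derivative of \<open>p\<close>. Only
  \<open>s\<close> of degree \<open>e - j - mdeg a\<close> matter, and this is below
  \<open>mdeg a\<close> by the assumption on \<open>e\<close>.\<close>

lemma phi_F_in_Ann:
  assumes n: "n \<ge> 1" and a: "keys a \<subseteq> {1..n - 1}" and e: "e < j + 2 * mdeg a"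
  shows "phi (Var n ^ j * F n a) \<in> Ann n (complete_sym n e :: (nat, 'k::field_char_0) mpoly)"
proof -
  define p :: "(nat, 'k) mpoly" where "p = Var n ^ j * F n a"
  have pf: "keys p \<subseteq> multi_indices n (j + mdeg a)"
    using forms_mult[OF Var_power_forms F_forms[OF a], of n j] n by (auto simp: p_def forms_def)
  have "lin_ext (\<lambda>m. dcoeff (complete_sym n e) (m + s)) (phi p) = 0" for s
  proof (cases "keys s \<subseteq> {1..n} \<and> mdeg s + (j + mdeg a) = e")
    case True
    have "lin_ext (\<lambda>m. dcoeff (complete_sym n e) (m + s)) (phi p)
        = of_nat (mfact s) * lin_ext (\<lambda>m. mbinom m s) p"
      unfolding lin_ext_phi unfolding lin_ext_def sum_distrib_left
    proof (rule sum.cong[OF refl])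
      fix m assume "m \<in> keys p"
      then have "m + s \<in> multi_indices n e" using pf True
        by (auto simp: multi_indices_def mdeg_add keys_mono_add)
      then show "lookup p m * (dcoeff (complete_sym n e) (m + s) / of_nat (mfact m))
          = of_nat (mfact s) * (lookup p m * mbinom m s)"
        by (simp add: dcoeff_complete_sym mbinom_def)
    qed
    also have "lin_ext (\<lambda>m. mbinom m s) p = 0"
      using lin_ext_mbinom_F[OF a, of s "Var n ^ j"] True e by (simp add: p_def mult.commute)
    finally show ?thesis by simp
  next
    case False
    then have "m + s \<notin> multi_indices n e" if "m \<in> keys p" for m
      using subsetD[OF pf that] by (auto simp: multi_indices_def mdeg_add keys_mono_add)
    then show ?thesis by (simp add: lin_ext_phi lin_ext_def dcoeff_complete_sym)
  qed
  then have "act (phi p) (complete_sym n e :: (nat, 'k) mpoly) = 0" by (simp add: act_eq_0_iff)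
  moreover have "phi p \<in> carrier (poly_ring n)"
    using pf by (auto simp: poly_ring_def vars_def multi_indices_def)
  ultimately show ?thesis by (simp add: Ann_def p_def)
qed

section \<open>Catalecticant determinants\<close>

text \<open>The list \<open>xs\<close> merely orders a finite index set, so that matrices with
  numbered rows and columns can be indexed by monomials.\<close>

definition gram :: "'b list \<Rightarrow> ('b \<Rightarrow> 'b \<Rightarrow> 'a) \<Rightarrow> 'a mat" where
  "gram xs f = mat (length xs) (length xs) (\<lambda>(i, j). f (xs ! i) (xs ! j))"

lemma gram_carrier [simp]: "gram xs f \<in> carrier_mat (length xs) (length xs)"
  by (simp add: gram_def)

lemma sum_nth_distinct:
  "distinct xs \<Longrightarrow> (\<Sum>j = 0..<length xs. g (xs ! j)) = (\<Sum>x\<in>set xs. g x)"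
  by (rule sum.reindex_bij_betw) (auto simp: bij_betw_def inj_on_nth set_conv_nth)

lemma gram_mult_vec:
  assumes "distinct xs" "i < length xs"
  shows "(gram xs f *\<^sub>v vec (length xs) (\<lambda>j. v (xs ! j))) $ i = (\<Sum>x\<in>set xs. f (xs ! i) x * v x)"
  using assms by (simp add: gram_def scalar_prod_def sum_nth_distinct[of xs "\<lambda>x. f (xs ! i) x * v x"])

lemma vec_eq_distinct:
  assumes "distinct xs" "v \<in> carrier_vec (length xs)"
  obtains w where "v = vec (length xs) (\<lambda>j. w (xs ! j))"
proof
  show "v = vec (length xs) (\<lambda>j. (\<lambda>x. v $ (THE j. j < length xs \<and> xs ! j = x)) (xs ! j))"
  proof (rule eq_vecI)
    fix j assume j: "j < dim_vec (vec (length xs) (\<lambda>j. (\<lambda>x. v $ (THE j. j < length xs \<and> xs ! j = x)) (xs ! j)))"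
    then have "(THE j'. j' < length xs \<and> xs ! j' = xs ! j) = j"
      using assms(1) by (intro the_equality) (auto simp: nth_eq_iff_index_eq)
    then show "v $ j = vec (length xs) (\<lambda>j. (\<lambda>x. v $ (THE j. j < length xs \<and> xs ! j = x)) (xs ! j)) $ j"
      using j by simp
  qed (use assms in auto)
qed

lemma det_gram_neq_0_iff:
  fixes f :: "'b \<Rightarrow> 'b \<Rightarrow> 'a::field"
  assumes "distinct xs"
  shows "det (gram xs f) \<noteq> 0 \<longleftrightarrow>
    (\<forall>v. (\<forall>y\<in>set xs. (\<Sum>x\<in>set xs. f y x * v x) = 0) \<longrightarrow> (\<forall>x\<in>set xs. v x = 0))"
proof -
  let ?N = "length xs"
  let ?v = "\<lambda>w. vec ?N (\<lambda>j. w (xs ! j))"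
  have "?v w = 0\<^sub>v ?N \<longleftrightarrow> (\<forall>x\<in>set xs. w x = 0)" for w :: "'b \<Rightarrow> 'a"
    by (auto simp: vec_eq_iff all_set_conv_all_nth)
  moreover have "gram xs f *\<^sub>v ?v w = 0\<^sub>v ?N \<longleftrightarrow> (\<forall>y\<in>set xs. (\<Sum>x\<in>set xs. f y x * w x) = 0)" for w
  proof -
    have "gram xs f *\<^sub>v ?v w = 0\<^sub>v ?N \<longleftrightarrow> (\<forall>i<?N. (gram xs f *\<^sub>v ?v w) $ i = 0)"
      by (auto simp: vec_eq_iff gram_def)
    also have "\<dots> \<longleftrightarrow> (\<forall>y\<in>set xs. (\<Sum>x\<in>set xs. f y x * w x) = 0)"
      by (simp add: gram_mult_vec[OF assms] all_set_conv_all_nth)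
    finally show ?thesis .
  qed
  moreover have "det (gram xs f) = 0 \<longleftrightarrow> (\<exists>w. ?v w \<noteq> 0\<^sub>v ?N \<and> gram xs f *\<^sub>v ?v w = 0\<^sub>v ?N)"
    unfolding det_0_iff_vec_prod_zero_field[OF gram_carrier]
    by (metis vec_eq_distinct[OF assms] vec_carrier)
  ultimately show ?thesis by auto
qed

lemma det_gram_solve:
  fixes f :: "'b \<Rightarrow> 'b \<Rightarrow> 'a::field"
  assumes "distinct xs" "det (gram xs f) \<noteq> 0"
  shows "\<exists>v. \<forall>y\<in>set xs. (\<Sum>x\<in>set xs. f y x * v x) = w y"
proof -
  let ?N = "length xs" and ?A = "gram xs f"
  have "?A \<in> Units (ring_mat TYPE('a) ?N ())"
    by (rule det_non_zero_imp_unit[OF gram_carrier assms(2)])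
  then obtain B where B: "B \<in> carrier_mat ?N ?N" and AB: "?A * B = 1\<^sub>m ?N"
    unfolding Units_def ring_mat_def by auto
  let ?w = "vec ?N (\<lambda>j. w (xs ! j))"
  obtain v where v: "B *\<^sub>v ?w = vec ?N (\<lambda>j. v (xs ! j))"
    using vec_eq_distinct[OF assms(1), of "B *\<^sub>v ?w"] B by (metis mult_mat_vec_carrier vec_carrier)
  have "?A *\<^sub>v (B *\<^sub>v ?w) = ?w"
    using assoc_mult_mat_vec[OF gram_carrier B, of ?w f] AB by simp
  then have eq: "?A *\<^sub>v vec ?N (\<lambda>j. v (xs ! j)) = ?w" by (simp add: v)
  have "(\<Sum>x\<in>set xs. f y x * v x) = w y" if y: "y \<in> set xs" for y
  proof -
    obtain i where i: "i < ?N" "y = xs ! i" using y by (auto simp: in_set_conv_nth)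
    then show ?thesis using gram_mult_vec[OF assms(1) i(1), of f v] by (simp add: eq)
  qed
  then show ?thesis by blast
qed

lemma (in comm_ring_hom) hom_det_gram: "hom (det (gram xs f)) = det (gram xs (\<lambda>y x. hom (f y x)))"
proof -
  have "map_mat hom (gram xs f) = gram xs (\<lambda>y x. hom (f y x))" by (auto simp: gram_def)
  then show ?thesis by (metis hom_det)
qed

text \<open>Both determinants are images of the same integer determinant, and the integers embed in
  every field of characteristic zero.\<close>

lemma det_gram_of_nat_transfer:
  assumes "det (gram xs (\<lambda>y x. of_nat (g y x) :: real)) \<noteq> 0"
  shows "det (gram xs (\<lambda>y x. of_nat (g y x) :: 'k::field_char_0)) \<noteq> 0"
proof -
  let ?d = "det (gram xs (\<lambda>y x. int (g y x)))"
  have "of_int ?d = det (gram xs (\<lambda>y x. of_nat (g y x) :: real))"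
    by (simp only: of_int_hom.hom_det_gram of_int_of_nat_eq)
  then have "?d \<noteq> 0" using assms by (metis of_int_0)
  then have "(of_int ?d :: 'k) \<noteq> 0" by simp
  then show ?thesis by (simp only: of_int_hom.hom_det_gram of_int_of_nat_eq not_False_eq_True)
qed

text \<open>The Laguerre polynomials with parameter \<open>q\<close> diagonalise the moments \<open>(i + j + q)!\<close> of the
  weight \<open>x^q * exp (- x)\<close>; \<open>moment_root q k i\<close> is, up to sign, the coefficient of the \<open>k\<close>-th one
  in \<open>x^i\<close>.\<close>

definition moment_root :: "nat \<Rightarrow> nat \<Rightarrow> nat \<Rightarrow> real" where
  "moment_root q k i = fact i * real ((i + q) choose (k + q))"

text \<open>Vandermonde's identity for the binomial coefficient of \<open>i + j + q\<close> over
  \<open>i\<close>. It gives a factorization \<open>L D L^T\<close> of the moment matrix with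
  \<open>L\<close> triangular and \<open>D\<close> positive diagonal.\<close>

lemma fact_moment:
  assumes "i \<le> N"
  shows "real (fact (i + j + q)) =
    (\<Sum>k\<le>N. fact (k + q) / fact k * (moment_root q k i * moment_root q k j))"
proof -
  have summand: "fact (k + q) / fact k * (moment_root q k i * moment_root q k j)
      = fact i * fact (j + q) * real ((j choose k) * ((i + q) choose (i - k)))" if k: "k \<le> i" for k
  proof -
    have "(i + q) choose (k + q) = (i + q) choose (i - k)"
      using binomial_symmetric[of "k + q" "i + q"] k by simp
    \<comment> \<open>Absorbing the weight into the factor for \<open>j\<close> turns its binomial
      coefficient into that of \<open>j\<close> over \<open>k\<close>, as Vandermonde's identity
      requires.\<close>
    moreover have "fact (k + q) / fact k * (fact j * real ((j + q) choose (k + q)))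
      = fact (j + q) * real (j choose k)"
    proof (cases "k \<le> j")
      case True
      then show ?thesis
        using binomial_fact[of "k + q" "j + q", where ?'a = real] binomial_fact[of k j, where ?'a = real]
        by simp
    qed (simp add: binomial_eq_0)
    moreover have "fact (k + q) / fact k * (moment_root q k i * moment_root q k j)
      = fact i * real ((i + q) choose (k + q)) * (fact (k + q) / fact k * (fact j * real ((j + q) choose (k + q))))"
      by (simp add: moment_root_def)
    ultimately show ?thesis by simp
  qed
  have "(\<Sum>k\<le>N. fact (k + q) / fact k * (moment_root q k i * moment_root q k j))
      = (\<Sum>k\<le>i. fact (k + q) / fact k * (moment_root q k i * moment_root q k j))"
    using assms by (intro sum.mono_neutral_right) (auto simp: moment_root_def)
  also have "\<dots> = fact i * fact (j + q) * real (\<Sum>k\<le>i. (j choose k) * ((i + q) choose (i - k)))"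
    by (simp only: of_nat_sum sum_distrib_left) (rule sum.cong[OF refl], rule summand, simp)
  also have "\<dots> = fact i * fact (j + q) * real ((j + (i + q)) choose i)"
    by (simp only: vandermonde)
  also have "\<dots> = real (fact (i + j + q))"
    using binomial_fact[of i "j + (i + q)", where ?'a = real] by (simp add: add_ac)
  finally show ?thesis by simp
qed

section \<open>Nonsingularity of the factorial moment matrices\<close>

definition mlist :: "nat \<Rightarrow> nat \<Rightarrow> nat mono list" where
  "mlist n c = (SOME xs. set xs = multi_indices n c \<and> distinct xs)"

lemma mlist: "set (mlist n c) = multi_indices n c" "distinct (mlist n c)"
  using someI_ex[OF finite_distinct_list[OF finite_multi_indices[of n c]]]
  by (simp_all add: mlist_def)

text \<open>For \<open>f = dcoeff G\<close> and \<open>q = e - 2 * c\<close> this is the matrix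
  \<open>A c\<close> described at the beginning.\<close>

definition hankel :: "nat \<Rightarrow> nat \<Rightarrow> nat \<Rightarrow> (nat mono \<Rightarrow> 'a) \<Rightarrow> 'a mat" where
  "hankel n c q f = gram (mlist n c) (\<lambda>s m. f (s + m + Poly_Mapping.single n q))"

lemma lookup_le_mdeg: "lookup m i \<le> mdeg m"
proof (cases "i \<in> keys m")
  case True
  then show ?thesis unfolding mdeg_def by (intro member_le_sum) auto
qed (simp add: in_keys_iff)

lemma mono_eqI:
  assumes "keys s \<subseteq> A" "keys t \<subseteq> A" "\<And>i. i \<in> A \<Longrightarrow> lookup s i \<le> lookup t i" "mdeg s = mdeg (t :: 'v mono)"
  shows "s = t"
proof (rule mono_le_mdeg_eq)
  fix i show "lookup s i \<le> lookup t i"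
    using assms(3)[of i] assms(1) by (cases "i \<in> keys s") (auto simp: not_in_keys_iff_lookup_eq_zero)
qed fact

text \<open>Multiplying the decompositions of \<open>fact_moment\<close> over all variables makes
  the quadratic form a sum of squares with positive weights. So all linear forms given by
  \<open>U\<close> vanish on a kernel vector, and these forms are triangular.\<close>

lemma det_hankel_mfact_real:
  assumes "n \<ge> 1"
  shows "det (hankel n c q (\<lambda>l. of_nat (mfact l) :: real)) \<noteq> 0"
  unfolding hankel_def det_gram_neq_0_iff[OF mlist(2)] mlist(1)
proof (intro allI impI)
  let ?M = "multi_indices n c"
  \<comment> \<open>The factor \<open>x_n^q\<close> shifts only the exponent of \<open>x_n\<close>;
    the other coordinates have parameter 0.\<close>
  define r where "r i = (if i = n then q else 0)" for i
  define K where "K = (\<Pi>\<^sub>E i\<in>{1..n}. {..c})"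
  define W where "W \<kappa> = (\<Prod>i\<in>{1..n}. fact (\<kappa> i + r i) / fact (\<kappa> i) :: real)" for \<kappa>
  define U where "U m \<kappa> = (\<Prod>i\<in>{1..n}. moment_root (r i) (\<kappa> i) (lookup m i))" for m \<kappa>
  have W: "W \<kappa> > 0" for \<kappa> unfolding W_def by (intro prod_pos) simp
  have gram: "real (mfact (s + m + Poly_Mapping.single n q)) = (\<Sum>\<kappa>\<in>K. W \<kappa> * (U s \<kappa> * U m \<kappa>))"
    if sm: "s \<in> ?M" "m \<in> ?M" for s m
  proof -
    have "mfact (s + m + Poly_Mapping.single n q)
        = (\<Prod>i\<in>{1..n}. fact (lookup (s + m + Poly_Mapping.single n q) i))"
      using sm assms by (intro mfact_superset) (auto simp: keys_mono_add multi_indices_def)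
    also have "\<dots> = (\<Prod>i\<in>{1..n}. fact (lookup s i + lookup m i + r i))"
      by (rule prod.cong) (auto simp: lookup_add lookup_single r_def)
    finally have "real (mfact (s + m + Poly_Mapping.single n q))
        = (\<Prod>i\<in>{1..n}. real (fact (lookup s i + lookup m i + r i)))" by simp
    also have "\<dots> = (\<Prod>i\<in>{1..n}. \<Sum>k\<le>c. fact (k + r i) / fact k *
        (moment_root (r i) k (lookup s i) * moment_root (r i) k (lookup m i)))"
      using sm(1) lookup_le_mdeg[of s] by (intro prod.cong refl fact_moment) (auto simp: multi_indices_def)
    also have "\<dots> = (\<Sum>\<kappa>\<in>K. \<Prod>i\<in>{1..n}. fact (\<kappa> i + r i) / fact (\<kappa> i) *
        (moment_root (r i) (\<kappa> i) (lookup s i) * moment_root (r i) (\<kappa> i) (lookup m i)))"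
      unfolding K_def by (intro prod_sum_PiE) auto
    also have "\<dots> = (\<Sum>\<kappa>\<in>K. W \<kappa> * (U s \<kappa> * U m \<kappa>))"
      by (simp only: W_def U_def prod.distrib)
    finally show ?thesis .
  qed
  fix v assume v: "\<forall>s\<in>?M. (\<Sum>m\<in>?M. real (mfact (s + m + Poly_Mapping.single n q)) * v m) = 0"
  have K: "finite K" unfolding K_def by (intro finite_PiE) auto
  have "0 = (\<Sum>s\<in>?M. v s * (\<Sum>m\<in>?M. real (mfact (s + m + Poly_Mapping.single n q)) * v m))"
    using v by simp
  also have "\<dots> = (\<Sum>s\<in>?M. v s * (\<Sum>m\<in>?M. (\<Sum>\<kappa>\<in>K. W \<kappa> * (U s \<kappa> * U m \<kappa>)) * v m))"
    by (simp add: gram)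
  also have "\<dots> = (\<Sum>s\<in>?M. \<Sum>m\<in>?M. \<Sum>\<kappa>\<in>K. W \<kappa> * ((v s * U s \<kappa>) * (v m * U m \<kappa>)))"
    by (simp add: sum_distrib_left sum_distrib_right mult_ac)
  also have "\<dots> = (\<Sum>s\<in>?M. \<Sum>\<kappa>\<in>K. \<Sum>m\<in>?M. W \<kappa> * ((v s * U s \<kappa>) * (v m * U m \<kappa>)))"
    by (intro sum.cong refl sum.swap)
  also have "\<dots> = (\<Sum>\<kappa>\<in>K. \<Sum>s\<in>?M. \<Sum>m\<in>?M. W \<kappa> * ((v s * U s \<kappa>) * (v m * U m \<kappa>)))"
    by (rule sum.swap)
  also have "\<dots> = (\<Sum>\<kappa>\<in>K. W \<kappa> * (\<Sum>m\<in>?M. v m * U m \<kappa>)\<^sup>2)"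
    by (simp only: power2_eq_square sum_product) (simp only: sum_distrib_left)
  finally have "(\<Sum>\<kappa>\<in>K. W \<kappa> * (\<Sum>m\<in>?M. v m * U m \<kappa>)\<^sup>2) = 0" by simp
  then have "\<forall>\<kappa>\<in>K. W \<kappa> * (\<Sum>m\<in>?M. v m * U m \<kappa>)\<^sup>2 = 0"
    using K W by (subst (asm) sum_nonneg_eq_0_iff) (auto simp: less_imp_le)
  then have zero: "(\<Sum>m\<in>?M. v m * U m \<kappa>) = 0" if "\<kappa> \<in> K" for \<kappa>
    using that W[of \<kappa>] by auto
  show "\<forall>l\<in>?M. v l = 0"
  proof
    fix l assume l: "l \<in> ?M"
    \<comment> \<open>For this exponent vector \<open>U m \<kappa>\<close> is nonzero only if
      \<open>l\<close> divides \<open>m\<close>; in equal degrees this leaves \<open>m = l\<close>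
      alone.\<close>
    define \<kappa> where "\<kappa> = restrict (lookup l) {1..n}"
    have "\<kappa> \<in> K" using l lookup_le_mdeg[of l] by (auto simp: K_def \<kappa>_def multi_indices_def)
    have "U m \<kappa> = 0" if m: "m \<in> ?M" "m \<noteq> l" for m
    proof (rule ccontr)
      assume "U m \<kappa> \<noteq> 0"
      have "lookup l i \<le> lookup m i" if i: "i \<in> {1..n}" for i
      proof (rule ccontr)
        assume "\<not> lookup l i \<le> lookup m i"
        then have "moment_root (r i) (\<kappa> i) (lookup m i) = 0"
          using i by (simp add: moment_root_def \<kappa>_def binomial_eq_0)
        then have "U m \<kappa> = 0" unfolding U_def using i by (intro prod_zero) auto
        then show False using \<open>U m \<kappa> \<noteq> 0\<close> by simp
      qed
      then have "l = m" using l m(1) by (intro mono_eqI[of _ "{1..n}"]) (auto simp: multi_indices_def)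
      then show False using m(2) by simp
    qed
    then have "(\<Sum>m\<in>?M. v m * U m \<kappa>) = v l * U l \<kappa>"
      using l by (subst sum.remove[OF finite_multi_indices l]) simp
    moreover have "U l \<kappa> \<noteq> 0" by (simp add: U_def moment_root_def \<kappa>_def)
    ultimately show "v l = 0" using zero[OF \<open>\<kappa> \<in> K\<close>] by simp
  qed
qed

section \<open>Determinants as polynomials in the coefficients of a form\<close>

lemma poly_eval_eq_lin_ext: "poly_eval P c = lin_ext (\<lambda>m. \<Prod>v\<in>keys m. c v ^ lookup m v) P"
  by (simp add: poly_eval_def lin_ext_def)

lemma monomial_eval_add:
  fixes c :: "'v \<Rightarrow> 'k::comm_ring_1"
  shows "(\<Prod>v\<in>keys (s + t). c v ^ lookup (s + t) v)
    = (\<Prod>v\<in>keys s. c v ^ lookup s v) * (\<Prod>v\<in>keys t. c v ^ lookup t v)"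
proof -
  have "(\<Prod>v\<in>keys s. c v ^ lookup s v) = (\<Prod>v\<in>keys (s + t). c v ^ lookup s v)"
    by (rule prod.mono_neutral_left) (auto simp: keys_mono_add in_keys_iff)
  moreover have "(\<Prod>v\<in>keys t. c v ^ lookup t v) = (\<Prod>v\<in>keys (s + t). c v ^ lookup t v)"
    by (rule prod.mono_neutral_left) (auto simp: keys_mono_add in_keys_iff)
  ultimately show ?thesis by (simp add: lookup_add power_add prod.distrib)
qed

text \<open>Lets evaluation at the coefficients of a form pass through products and, by
  \<open>hom_det_gram\<close>, through determinants.\<close>

lemma comm_ring_hom_poly_eval: "comm_ring_hom (\<lambda>P :: ('v, 'k::comm_ring_1) mpoly. poly_eval P c)"
proof
  fix P Q :: "('v, 'k) mpoly"
  show "poly_eval (P * Q) c = poly_eval P c * poly_eval Q c"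
    by (simp add: poly_eval_eq_lin_ext lin_ext_mult monomial_eval_add)
      (simp add: lin_ext_def sum_product mult_ac)
  show "poly_eval (1 :: ('v, 'k) mpoly) c = 1"
    by (simp add: poly_eval_def lookup_one)
qed (simp_all add: poly_eval_eq_lin_ext lin_ext_add)

lemma vars_sum: "(\<And>x. x \<in> A \<Longrightarrow> vars (f x) \<subseteq> V) \<Longrightarrow> vars (sum f A) \<subseteq> V"
proof (induction A rule: infinite_finite_induct)
  case (insert x A)
  then show ?case using vars_add[of "f x" "sum f A"] by auto
qed (auto simp: vars_def)

lemma vars_prod:
  fixes f :: "'a \<Rightarrow> ('v, 'k::comm_ring_1) mpoly"
  shows "(\<And>x. x \<in> A \<Longrightarrow> vars (f x) \<subseteq> V) \<Longrightarrow> vars (prod f A) \<subseteq> V"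
proof (induction A rule: infinite_finite_induct)
  case (insert x A)
  then show ?case using vars_mult[of "f x" "prod f A"] by auto
qed (auto simp: vars_def)

lemma vars_det_gram:
  fixes f :: "'a \<Rightarrow> 'a \<Rightarrow> ('v, 'k::comm_ring_1) mpoly"
  assumes "\<And>x y. x \<in> set xs \<Longrightarrow> y \<in> set xs \<Longrightarrow> vars (f x y) \<subseteq> V"
  shows "vars (det (gram xs f)) \<subseteq> V"
  unfolding det_def'[OF gram_carrier]
proof (rule vars_sum)
  fix p assume p: "p \<in> {p. p permutes {0..<length xs}}"
  have "vars (\<Prod>i = 0..<length xs. gram xs f $$ (i, p i)) \<subseteq> V"
  proof (rule vars_prod)
    fix i assume "i \<in> {0..<length xs}"
    moreover from this have "p i < length xs" using p permutes_in_image[of p "{0..<length xs}" i] by simp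
    ultimately show "vars (gram xs f $$ (i, p i)) \<subseteq> V" using assms by (simp add: gram_def)
  qed
  moreover have "vars (signof p :: ('v, 'k) mpoly) = {}"
    by (auto simp: sign_def vars_def)
  ultimately show "vars (signof p * (\<Prod>i = 0..<length xs. gram xs f $$ (i, p i))) \<subseteq> V"
    using vars_mult[of "signof p :: ('v, 'k) mpoly" "\<Prod>i = 0..<length xs. gram xs f $$ (i, p i)"]
    by simp
qed

section \<open>Initial ideals\<close>

definition nondegenerate :: "nat \<Rightarrow> nat \<Rightarrow> (nat, 'k::field_char_0) mpoly \<Rightarrow> bool" where
  "nondegenerate n e G \<longleftrightarrow> (\<forall>c. 2 * c \<le> e \<longrightarrow> det (hankel n c (e - 2 * c) (dcoeff G)) \<noteq> 0)"

text \<open>For \<open>l = x_n^j * x^b\<close> the condition reads \<open>e < j + 2 * \<bar>b\<bar>\<close>.\<close>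

definition nonstandard :: "nat \<Rightarrow> nat \<Rightarrow> nat mono set" where
  "nonstandard n e = {l. keys l \<subseteq> {1..n} \<and> e + lookup l n < 2 * mdeg l}"

lemma dcoeff_form_eq_0: "G \<in> forms n e \<Longrightarrow> s \<notin> multi_indices n e \<Longrightarrow> dcoeff G s = 0"
  unfolding dcoeff_def forms_def by (metis (mono_tags, lifting) in_keys_iff mem_Collect_eq mult_zero_right subsetD)

lemma lead_mono_Ann_nonstandard:
  assumes n: "n \<ge> 1" and G: "G \<in> forms n e" "nondegenerate n e G"
    and f: "f \<in> Ann n G" "f \<noteq> 0"
  shows "lead_mono f \<in> nonstandard n e"
proof (rule ccontr)
  define l where "l = lead_mono f"
  define j where "j = lookup l n"
  define c where "c = mdeg l - j"
  define q where "q = e - 2 * c"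
  let ?x = "Poly_Mapping.single n :: nat \<Rightarrow> nat mono"
  let ?M = "multi_indices n c"
  have fk: "keys m \<subseteq> {1..n}" if "m \<in> keys f" for m
    using f(1) that by (auto simp: Ann_def poly_ring_def vars_def)
  have l: "l \<in> keys f" using lead_mono(1)[OF f(2)] by (simp add: l_def)
  assume "lead_mono f \<notin> nonstandard n e"
  then have "2 * mdeg l \<le> e + j" using fk[OF l] by (simp add: nonstandard_def l_def j_def)
  moreover have "j \<le> mdeg l" unfolding j_def by (rule lookup_le_mdeg)
  ultimately have c: "mdeg l = c + j" "2 * c \<le> e" "j \<le> q" "2 * c + q = e"
    by (auto simp: c_def q_def)
  \<comment> \<open>By \<open>drl_less_last_le\<close> no monomial of \<open>f\<close> of degree
    \<open>mdeg l\<close> has a smaller exponent of \<open>x_n\<close> than \<open>l\<close>, so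
    \<open>x_n^j\<close> divides the whole leading form.\<close>
  have decomp: "m \<in> (\<lambda>m. m + ?x j) ` ?M" if m: "m \<in> keys f" "mdeg m = mdeg l" for m
  proof -
    have "j \<le> lookup m n"
    proof (cases "m = l")
      case False
      then have "drl_less m l" using lead_mono(2)[OF f(2) m(1)] by (simp add: l_def)
      then show ?thesis using drl_less_last_le[of m l n] m fk l by (simp add: j_def)
    qed (simp add: j_def)
    then have m': "m = (m - ?x j) + ?x j"
      by (intro mono_diff_add[symmetric]) (auto simp: lookup_single when_def)
    have "keys (m - ?x j) \<subseteq> {1..n}" using fk[OF m(1)] m' keys_mono_add by (metis le_sup_iff)
    moreover have "mdeg (m - ?x j) = c"
      using m(2) m' mdeg_add[of "m - ?x j" "?x j"] c(1) by simp
    ultimately show ?thesis using m' by (auto simp: multi_indices_def)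
  qed
  \<comment> \<open>Testing \<open>f\<close> against \<open>s * x_n^(q - j)\<close>, of degree
    \<open>e - mdeg l\<close>, kills all terms outside the leading form; \<open>j \<le> q\<close>
    expresses that \<open>l\<close> is standard.\<close>
  have zero: "(\<Sum>m\<in>?M. dcoeff G (s + m + ?x q) * lookup f (m + ?x j)) = 0" if s: "s \<in> ?M" for s
  proof -
    let ?g = "\<lambda>m. lookup f m * dcoeff G (m + (s + ?x (q - j)))"
    let ?A = "(\<lambda>m. m + ?x j) ` ?M"
    have "act f G = 0" using f(1) by (simp add: Ann_def)
    then have "lin_ext (\<lambda>m. dcoeff G (m + (s + ?x (q - j)))) f = 0" by (simp add: act_eq_0_iff)
    then have "0 = (\<Sum>m\<in>?A \<union> keys f. ?g m)"
      by (subst (asm) lin_ext_superset[of "?A \<union> keys f"]) (auto simp: finite_multi_indices)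
    also have "\<dots> = (\<Sum>m\<in>?A. ?g m)"
    proof (rule sum.mono_neutral_right)
      show "\<forall>m\<in>?A \<union> keys f - ?A. ?g m = 0"
      proof
        fix m assume m: "m \<in> ?A \<union> keys f - ?A"
        then have "mdeg m \<noteq> mdeg l" using decomp by auto
        then have "m + (s + ?x (q - j)) \<notin> multi_indices n e"
          using c s by (auto simp: multi_indices_def mdeg_add)
        then show "?g m = 0" by (simp add: dcoeff_form_eq_0[OF G(1)])
      qed
    qed (auto simp: finite_multi_indices)
    also have "\<dots> = (\<Sum>m\<in>?M. ?g (m + ?x j))"
      by (subst sum.reindex) (auto simp: inj_on_def)
    also have "\<dots> = (\<Sum>m\<in>?M. dcoeff G (s + m + ?x q) * lookup f (m + ?x j))"
    proof (rule sum.cong[OF refl])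
      fix m
      have "?x j + ?x (q - j) = ?x q" using c(3) by (simp flip: single_add)
      moreover have "m + ?x j + (s + ?x (q - j)) = s + m + (?x j + ?x (q - j))" by (simp only: add_ac)
      ultimately have "m + ?x j + (s + ?x (q - j)) = s + m + ?x q" by simp
      then show "?g (m + ?x j) = dcoeff G (s + m + ?x q) * lookup f (m + ?x j)" by simp
    qed
    finally show ?thesis by simp
  qed
  have "det (hankel n c q (dcoeff G)) \<noteq> 0"
    using G(2) c(2) by (simp add: nondegenerate_def q_def)
  then have "(\<forall>s\<in>?M. (\<Sum>m\<in>?M. dcoeff G (s + m + ?x q) * v m) = 0) \<longrightarrow> (\<forall>m\<in>?M. v m = 0)" for v
    unfolding hankel_def det_gram_neq_0_iff[OF mlist(2)] mlist(1) by (rule spec)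
  from this[of "\<lambda>m. lookup f (m + ?x j)"] have "\<forall>m\<in>?M. lookup f (m + ?x j) = 0"
    using zero by blast
  then have "lookup f l = 0" using decomp[OF l refl] by blast
  then show False using l by (simp add: in_keys_iff)
qed

lemma nonstandard_is_lead_mono:
  fixes G :: "(nat, 'k::field_char_0) mpoly"
  assumes n: "n \<ge> 1" and G: "G \<in> forms n e" "nondegenerate n e G" and l: "l \<in> nonstandard n e"
  obtains f where "f \<in> Ann n G" "f \<noteq> 0" "lead_mono f = l"
proof (cases "e < mdeg l")
  case True
  let ?f = "Poly_Mapping.single l (1 :: 'k)"
  have "l + s \<notin> multi_indices n e" for s using True by (auto simp: multi_indices_def mdeg_add)
  then have "act ?f G = 0" by (simp add: act_eq_0_iff dcoeff_form_eq_0[OF G(1)])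
  then have "?f \<in> Ann n G" using l by (simp add: Ann_def single_carrier_iff nonstandard_def)
  moreover have "?f \<noteq> 0" by (metis lookup_single_eq lookup_zero zero_neq_one)
  moreover have "lead_mono ?f = l" by (rule lead_mono_eqI) auto
  ultimately show thesis by (rule that)
next
  case False
  define c where "c = e - mdeg l"
  define q where "q = e - 2 * c"
  let ?x = "Poly_Mapping.single n :: nat \<Rightarrow> nat mono"
  let ?M = "multi_indices n c"
  \<comment> \<open>Since \<open>q = 2 * mdeg l - e\<close>, the bound \<open>lookup l n < q\<close>
    is the nonstandardness of \<open>l\<close>. It makes \<open>l\<close> larger than all terms of
    \<open>h\<close> below, which are divisible by \<open>x_n^q\<close>.\<close>
  have lk: "keys l \<subseteq> {1..n}" and c: "2 * c \<le> e" "mdeg l = c + q" "mdeg l + c = e" "lookup l n < q"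
    using l False by (auto simp: nonstandard_def c_def q_def)
  have "det (gram (mlist n c) (\<lambda>s m. dcoeff G (s + m + ?x q))) \<noteq> 0"
    using G(2) c(1) by (simp add: nondegenerate_def q_def hankel_def)
  \<comment> \<open>The right-hand side makes \<open>l\<close> and \<open>x_n^q * g\<close>, where
    \<open>g\<close> has coefficients \<open>v\<close>, pair equally with each test monomial
    \<open>s\<close> of degree \<open>c\<close>.\<close>
  from det_gram_solve[OF mlist(2) this, unfolded mlist(1), of "\<lambda>s. dcoeff G (l + s)"]
  obtain v where v: "\<forall>s\<in>?M. (\<Sum>m\<in>?M. dcoeff G (s + m + ?x q) * v m) = dcoeff G (l + s)" ..
  define h where "h = (\<Sum>m\<in>?M. Poly_Mapping.single (m + ?x q) (v m))"
  define f where "f = Poly_Mapping.single l 1 - h"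
  have hk: "m \<in> multi_indices n (mdeg l) \<and> q \<le> lookup m n" if "m \<in> keys h" for m
  proof -
    have "m \<in> (\<Union>m\<in>?M. keys (Poly_Mapping.single (m + ?x q) (v m)))"
      using that unfolding h_def by (rule subsetD[OF keys_sum])
    then obtain m' where "m' \<in> ?M" "m = m' + ?x q" by (auto split: if_splits)
    then show ?thesis using n c(2)
      by (auto simp: multi_indices_def mdeg_add keys_mono_add lookup_add)
  qed
  have "lookup h l = 0" using hk[of l] c(4) by (auto simp: in_keys_iff)
  then have lf: "l \<in> keys f" by (simp add: f_def in_keys_iff lookup_minus)
  have fk: "m \<in> keys h" if "m \<in> keys f" "m \<noteq> l" for m
    using that by (auto simp: f_def in_keys_iff lookup_minus lookup_single when_def)
  have "lin_ext (\<lambda>m. dcoeff G (m + s)) f = 0" for s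
  proof -
    have eq: "lin_ext (\<lambda>m. dcoeff G (m + s)) f
        = dcoeff G (l + s) - (\<Sum>m\<in>?M. dcoeff G (s + m + ?x q) * v m)"
      by (simp add: f_def h_def lin_ext_diff lin_ext_sum add_ac mult.commute)
    show ?thesis
    proof (cases "s \<in> ?M")
      \<comment> \<open>Other test monomials lead outside degree \<open>e\<close> or outside the
        variables, where \<open>dcoeff G\<close> vanishes.\<close>
      case False
      have "dcoeff G (s + m + ?x q) = 0" if "m \<in> ?M" for m
        using False that c by (intro dcoeff_form_eq_0[OF G(1)])
          (auto simp: multi_indices_def mdeg_add keys_mono_add)
      moreover have "dcoeff G (l + s) = 0"
        using False c by (intro dcoeff_form_eq_0[OF G(1)])
          (auto simp: multi_indices_def mdeg_add keys_mono_add)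
      ultimately show ?thesis by (simp add: eq)
    qed (simp add: eq v)
  qed
  then have "act f G = 0" by (simp add: act_eq_0_iff)
  moreover have "f \<in> carrier (poly_ring n)"
    using fk hk lk by (fastforce simp: poly_ring_def vars_def multi_indices_def)
  ultimately have "f \<in> Ann n G" by (simp add: Ann_def)
  moreover have "f \<noteq> 0" using lf by auto
  moreover have "lead_mono f = l"
  proof (rule lead_mono_eqI[OF lf])
    fix m assume "m \<in> keys f" "m \<noteq> l"
    from hk[OF fk[OF this]] show "drl_less m l"
      using lk c(4) by (intro drl_less_last[of _ _ n]) (auto simp: multi_indices_def)
  qed
  ultimately show thesis by (rule that)
qed

lemma lead_monos_Ann:
  assumes "n \<ge> 1" "G \<in> forms n e" "nondegenerate n e G"
  shows "lead_mono ` (Ann n G - {0}) = nonstandard n e"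
proof
  show "nonstandard n e \<subseteq> lead_mono ` (Ann n G - {0})"
  proof
    fix l assume "l \<in> nonstandard n e"
    from nonstandard_is_lead_mono[OF assms this] obtain f where
      "f \<in> Ann n G" "f \<noteq> 0" "lead_mono f = l" .
    then show "l \<in> lead_mono ` (Ann n G - {0})" by blast
  qed
qed (use lead_mono_Ann_nonstandard[OF assms] in auto)

section \<open>Nondegeneracy of \<open>H_e\<close> and of generic forms\<close>

lemma complete_sym_forms: "(complete_sym n e :: (nat, 'k::comm_ring_1) mpoly) \<in> forms n e"
proof -
  have "keys (complete_sym n e :: (nat, 'k) mpoly) \<subseteq> multi_indices n e"
    by (auto simp: in_keys_iff complete_sym_def lookup_sum lookup_single
      when_def sum.delta' finite_multi_indices split: if_splits)
  then show ?thesis by (simp add: forms_def)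
qed

text \<open>All coefficients of \<open>H_e\<close> are 1, so its matrices consist of factorials;
  their nonsingularity over the reals carries over to the field.\<close>

lemma nondegenerate_complete_sym:
  assumes "n \<ge> 1"
  shows "nondegenerate n e (complete_sym n e :: (nat, 'k::field_char_0) mpoly)"
  unfolding nondegenerate_def
proof (intro allI impI)
  fix c assume c: "2 * c \<le> e"
  let ?q = "e - 2 * c"
  have "s + m + Poly_Mapping.single n ?q \<in> multi_indices n e"
    if "s \<in> multi_indices n c" "m \<in> multi_indices n c" for s m
    using that c assms by (auto simp: multi_indices_def mdeg_add keys_mono_add)
  then have "hankel n c ?q (dcoeff (complete_sym n e))
      = (hankel n c ?q (\<lambda>l. of_nat (mfact l)) :: 'k mat)"
    unfolding hankel_def gram_def
    by (intro cong_mat) (auto simp: dcoeff_complete_sym simp flip: mlist(1) dest: nth_mem)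
  moreover have "det (hankel n c ?q (\<lambda>l. of_nat (mfact l)) :: 'k mat) \<noteq> 0"
    using det_hankel_mfact_real[OF assms] unfolding hankel_def by (rule det_gram_of_nat_transfer)
  ultimately show "det (hankel n c ?q (dcoeff (complete_sym n e :: (nat, 'k) mpoly))) \<noteq> 0" by simp
qed

text \<open>The variable standing for the coefficient at \<open>l\<close> carries the factor
  \<open>l!\<close>, so evaluation at \<open>lookup G\<close> turns the matrix entries into values
  of \<open>dcoeff G\<close>.\<close>

definition discriminant :: "nat \<Rightarrow> nat \<Rightarrow> (nat mono, 'k::field_char_0) mpoly" where
  "discriminant n e = (\<Prod>c\<in>{..e div 2}. det (hankel n c (e - 2 * c)
     (\<lambda>l. Poly_Mapping.single (Poly_Mapping.single l 1) (of_nat (mfact l)))))"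

lemma poly_eval_discriminant:
  fixes G :: "(nat, 'k::field_char_0) mpoly"
  shows "poly_eval (discriminant n e) (lookup G) \<noteq> 0 \<longleftrightarrow> nondegenerate n e G"
proof -
  interpret ev: comm_ring_hom "\<lambda>P :: (nat mono, 'k) mpoly. poly_eval P (lookup G)"
    by (rule comm_ring_hom_poly_eval)
  have "poly_eval (Poly_Mapping.single (Poly_Mapping.single l 1) (of_nat (mfact l))) (lookup G) = dcoeff G l" for l
    by (simp add: poly_eval_eq_lin_ext dcoeff_def)
  then have "poly_eval (discriminant n e) (lookup G)
      = (\<Prod>c\<in>{..e div 2}. det (hankel n c (e - 2 * c) (dcoeff G)))"
    by (simp only: discriminant_def ev.hom_prod hankel_def ev.hom_det_gram)
  then show ?thesis by (auto simp: nondegenerate_def)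
qed

lemma vars_discriminant:
  assumes "n \<ge> 1"
  shows "vars (discriminant n e :: (nat mono, 'k::field_char_0) mpoly) \<subseteq> multi_indices n e"
  unfolding discriminant_def hankel_def
proof (intro vars_prod vars_det_gram)
  fix c s m assume c: "c \<in> {..e div 2}" and sm: "s \<in> set (mlist n c)" "m \<in> set (mlist n c)"
  then have "s + m + Poly_Mapping.single n (e - 2 * c) \<in> multi_indices n e"
    using assms by (auto simp: mlist(1) multi_indices_def mdeg_add keys_mono_add)
  then show "vars (Poly_Mapping.single (Poly_Mapping.single (s + m + Poly_Mapping.single n (e - 2 * c)) 1)
      (of_nat (mfact (s + m + Poly_Mapping.single n (e - 2 * c))) :: 'k)) \<subseteq> multi_indices n e"
    by (auto simp: vars_def)
qed

section \<open>Minimal nonstandard monomials\<close>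

text \<open>The pairs \<open>(j, a)\<close> for which \<open>x_n^j * x^a\<close> is a minimal nonstandard monomial; the second
  alternative occurs only for even \<open>e\<close>.\<close>

definition corners :: "nat \<Rightarrow> nat \<Rightarrow> (nat \<times> nat mono) set" where
  "corners n e = {(j, a). keys a \<subseteq> {1..n - 1} \<and>
     (j + 2 * mdeg a = e + 1 \<or> j = 0 \<and> 2 * mdeg a = e + 2)}"

definition corner_poly :: "nat \<Rightarrow> nat \<times> nat mono \<Rightarrow> (nat, 'k::field_char_0) mpoly" where
  "corner_poly n = (\<lambda>(j, a). phi (Var n ^ j * F n a))"

definition corner_mono :: "nat \<Rightarrow> nat \<times> nat mono \<Rightarrow> nat mono" where
  "corner_mono n = (\<lambda>(j, a). a + Poly_Mapping.single n j)"

lemma lead_mono_corner_poly: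
  assumes "n \<ge> 1" "x \<in> corners n e"
  shows "lead_mono (corner_poly n x :: (nat, 'k::field_char_0) mpoly) = corner_mono n x"
    and "corner_poly n x \<noteq> (0 :: (nat, 'k) mpoly)"
proof -
  obtain j a where x: "x = (j, a)" "keys a \<subseteq> {1..n - 1}" using assms(2) by (auto simp: corners_def)
  show "lead_mono (corner_poly n x :: (nat, 'k) mpoly) = corner_mono n x"
    using lead_mono_phi_F(2)[OF assms(1) x(2)] by (simp add: x(1) corner_poly_def corner_mono_def)
  have "corner_mono n x \<in> keys (corner_poly n x :: (nat, 'k) mpoly)"
    using lead_mono_phi_F(1)[OF assms(1) x(2), of j, where 'k = 'k]
    by (simp add: x(1) corner_poly_def corner_mono_def)
  then show "corner_poly n x \<noteq> (0 :: (nat, 'k) mpoly)" by (metis empty_iff keys_zero)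
qed

lemma lookup_corner_mono:
  assumes "n \<ge> 1" "keys a \<subseteq> {1..n - 1}"
  shows "lookup (corner_mono n (j, a)) i = (if i = n then j else lookup a i)"
proof -
  have "lookup a n = 0" using assms by (force simp: in_keys_iff)
  then show ?thesis by (auto simp: corner_mono_def lookup_add lookup_single when_def)
qed

lemma corner_mono_antichain:
  assumes n: "n \<ge> 1" and x: "x \<in> corners n e" and y: "y \<in> corners n e"
    and le: "\<forall>i. lookup (corner_mono n x) i \<le> lookup (corner_mono n y) i"
  shows "x = y"
proof -
  obtain j a where xa: "x = (j, a)" "keys a \<subseteq> {1..n - 1}"
      "j + 2 * mdeg a = e + 1 \<or> j = 0 \<and> 2 * mdeg a = e + 2"
    using x by (auto simp: corners_def)
  obtain k b where yb: "y = (k, b)" "keys b \<subseteq> {1..n - 1}"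
      "k + 2 * mdeg b = e + 1 \<or> k = 0 \<and> 2 * mdeg b = e + 2"
    using y by (auto simp: corners_def)
  note lk = lookup_corner_mono[OF n xa(2), of j] lookup_corner_mono[OF n yb(2), of k]
  have jk: "j \<le> k" using le[rule_format, of n] by (simp add: xa(1) yb(1) lk)
  have ab: "lookup a i \<le> lookup b i" for i
  proof (cases "i = n")
    case True
    then have "i \<notin> keys a" using xa(2) n by (auto dest!: subsetD)
    then show ?thesis by (simp add: in_keys_iff)
  next
    case False
    then show ?thesis using le[rule_format, of i] by (simp add: xa(1) yb(1) lk)
  qed
  have "mdeg b = mdeg ((b - a) + a)" using mono_diff_add[of a b] ab by simp
  then have "mdeg a \<le> mdeg b" by (simp add: mdeg_add)
  \<comment> \<open>A proper divisor has a smaller value of \<open>j + 2 * A\<close>, so the two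
    values would be \<open>e + 1\<close> and \<open>e + 2\<close>. The latter forces
    \<open>k = 0\<close>, hence \<open>j = 0\<close>, and both values would be even.\<close>
  moreover have "A = B \<and> j = k"
    if "A \<le> B" "j + 2 * A = e + 1 \<or> j = 0 \<and> 2 * A = e + 2"
      "k + 2 * B = e + 1 \<or> k = 0 \<and> 2 * B = e + 2" for A B :: nat
    using that jk by (elim disjE conjE) presburger+
  ultimately have "mdeg a = mdeg b" "j = k" using xa(3) yb(3) by blast+
  then show ?thesis using mono_le_mdeg_eq[of a b] ab by (simp add: xa(1) yb(1))
qed

lemma corner_mono_nonstandard:
  assumes "n \<ge> 1" "x \<in> corners n e"
  shows "corner_mono n x \<in> nonstandard n e"
proof -
  obtain j a where x: "x = (j, a)" "keys a \<subseteq> {1..n - 1}" "e < j + 2 * mdeg a"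
    using assms(2) by (auto simp: corners_def)
  have "keys a \<subseteq> {1..n}" by (rule order_trans[OF x(2)]) auto
  then have "keys (corner_mono n x) \<subseteq> {1..n}"
    using assms(1) by (simp add: x(1) corner_mono_def keys_mono_add)
  moreover have "lookup (corner_mono n x) n = j" by (simp add: x(1) lookup_corner_mono[OF assms(1) x(2)])
  moreover have "mdeg (corner_mono n x) = mdeg a + j" by (simp add: x(1) corner_mono_def mdeg_add)
  ultimately show ?thesis using x(3) by (simp add: nonstandard_def)
qed

lemma nonstandard_corner_divides:
  assumes n: "n \<ge> 1" and l: "l \<in> nonstandard n e"
  shows "\<exists>x\<in>corners n e. \<forall>i. lookup (corner_mono n x) i \<le> lookup l i"
proof -
  define j where "j = lookup l n"
  define b where "b = l - Poly_Mapping.single n j"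
  have lb: "b + Poly_Mapping.single n j = l"
    unfolding b_def by (rule mono_diff_add) (simp add: lookup_single when_def j_def)
  have bn: "lookup b n = 0" by (simp add: b_def lookup_minus j_def)
  have b: "keys b \<subseteq> {1..n - 1}"
  proof
    fix i assume i: "i \<in> keys b"
    then have "i \<in> keys l" unfolding lb[symmetric] keys_mono_add by simp
    then have "i \<in> {1..n}" using l by (auto simp: nonstandard_def)
    moreover have "i \<noteq> n" using i bn by (auto simp: in_keys_iff)
    ultimately show "i \<in> {1..n - 1}" by auto
  qed
  have e: "e < j + 2 * mdeg b"
    using l mdeg_add[of b "Poly_Mapping.single n j"] lb by (simp add: nonstandard_def j_def)
  \<comment> \<open>If \<open>2 * mdeg b \<le> e + 1\<close>, lowering the exponent of
    \<open>x_n\<close> reaches the value \<open>e + 1\<close>. Otherwise \<open>x_n\<close> is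
    dropped altogether and \<open>c\<close> is half of \<open>e + 1\<close>, rounded up.\<close>
  obtain k c where kc: "k \<le> j" "c \<le> mdeg b" "k + 2 * c = e + 1 \<or> k = 0 \<and> 2 * c = e + 2"
  proof (cases "2 * mdeg b \<le> e + 1")
    case True
    then show thesis using that[of "e + 1 - 2 * mdeg b" "mdeg b"] e by auto
  next
    case False
    then have "(e + 2) div 2 \<le> mdeg b" by simp
    moreover have "0 + 2 * ((e + 2) div 2) = e + 1 \<or> 2 * ((e + 2) div 2) = e + 2" by presburger
    ultimately show thesis using that[of 0 "(e + 2) div 2"] by blast
  qed
  obtain a where a: "\<And>i. lookup a i \<le> lookup b i" "mdeg a = c"
    using ex_sub_multi_index[OF kc(2)] by blast
  have ak: "keys a \<subseteq> {1..n - 1}"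
  proof
    fix i assume "i \<in> keys a"
    then have "i \<in> keys b" using a(1)[of i] by (auto simp: in_keys_iff)
    then show "i \<in> {1..n - 1}" using b by blast
  qed
  have "(k, a) \<in> corners n e" using kc(3) ak a(2) by (simp add: corners_def)
  moreover have "lookup (corner_mono n (k, a)) i \<le> lookup l i" for i
  proof -
    have "lookup l i = lookup b i + (j when n = i)" by (metis lb lookup_add lookup_single)
    then show ?thesis using a(1)[of i] kc(1) bn by (auto simp: lookup_corner_mono[OF n ak])
  qed
  ultimately show ?thesis by blast
qed

lemma finite_corners: "finite (corners n e)"
proof (rule finite_subset)
  show "corners n e \<subseteq> {..e + 1} \<times> (\<Union>c\<in>{..e + 2}. multi_indices (n - 1) c)"
    by (auto simp: corners_def multi_indices_def)
qed (simp add: finite_multi_indices)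

text \<open>The corner monomials are nonstandard and every nonstandard monomial is divisible by one
  of them, so they generate the initial ideal; being an antichain, they do so minimally.\<close>

lemma minimal_groebner_basis_corners:
  assumes n: "n \<ge> 1"
  shows "minimal_groebner_basis n (corner_poly n ` corners n e :: (nat, 'k::field_char_0) mpoly set)
    (Ann n (complete_sym n e))"
proof -
  let ?B = "corner_poly n ` corners n e :: (nat, 'k) mpoly set"
  let ?M = "corner_mono n ` corners n e"
  have lead: "lead_mono ` ?B = ?M"
    by (auto simp: image_image lead_mono_corner_poly[OF n] cong: image_cong)
  have init: "initial_ideal n (Ann n (complete_sym n e))
      = (mono_ideal n (nonstandard n e) :: (nat, 'k) mpoly set)"
    by (simp add: initial_ideal_def lead_monos_Ann[OF n complete_sym_forms nondegenerate_complete_sym[OF n]])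
  have ns: "\<forall>m\<in>nonstandard n e. keys m \<subseteq> {1..n}" by (simp add: nonstandard_def)
  have Mns: "?M \<subseteq> nonstandard n e" using corner_mono_nonstandard[OF n] by auto
  then have Mk: "\<forall>m\<in>?M. keys m \<subseteq> {1..n}" using ns by blast
  have M: "mono_ideal n ?M = (mono_ideal n (nonstandard n e) :: (nat, 'k) mpoly set)"
  proof
    show "mono_ideal n ?M \<subseteq> (mono_ideal n (nonstandard n e) :: (nat, 'k) mpoly set)"
      using Mns by (intro mono_ideal_subset[OF Mk ns]) auto
    show "(mono_ideal n (nonstandard n e) :: (nat, 'k) mpoly set) \<subseteq> mono_ideal n ?M"
      using nonstandard_corner_divides[OF n] by (intro mono_ideal_subset[OF ns Mk]) auto
  qed
  have "?B \<subseteq> Ann n (complete_sym n e)"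
  proof (intro image_subsetI)
    fix x assume "x \<in> corners n e"
    then obtain j a where x: "x = (j, a)" "keys a \<subseteq> {1..n - 1}" "e < j + 2 * mdeg a"
      by (auto simp: corners_def)
    show "corner_poly n x \<in> Ann n (complete_sym n e :: (nat, 'k) mpoly)"
      using phi_F_in_Ann[OF n x(2,3)] by (simp add: x(1) corner_poly_def)
  qed
  moreover have "0 \<notin> ?B"
  proof
    assume "0 \<in> ?B"
    then obtain x where "x \<in> corners n e" "corner_poly n x = (0 :: (nat, 'k) mpoly)" by auto
    then show False using lead_mono_corner_poly(2)[OF n] by blast
  qed
  ultimately have "groebner_basis n ?B (Ann n (complete_sym n e))"
    by (simp add: groebner_basis_def finite_corners lead M init)
  moreover have "inj_on lead_mono ?B"
  proof (rule inj_onI)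
    fix p q assume "p \<in> ?B" "q \<in> ?B" and eq: "lead_mono p = lead_mono q"
    then obtain x y where x: "x \<in> corners n e" "p = corner_poly n x"
      and y: "y \<in> corners n e" "q = corner_poly n y" by blast
    have "corner_mono n x = corner_mono n y"
      using eq by (simp add: x y lead_mono_corner_poly(1)[OF n x(1)] lead_mono_corner_poly(1)[OF n y(1)])
    then have "x = y" using corner_mono_antichain[OF n x(1) y(1)] by simp
    then show "p = q" by (simp add: x y)
  qed
  moreover have "minimal_mono_gens n ?M (mono_ideal n (nonstandard n e) :: (nat, 'k) mpoly set)"
    unfolding minimal_mono_gens_def
  proof (intro conjI allI impI)
    fix N assume "N \<subset> ?M"
    have "(mono_ideal n N :: (nat, 'k) mpoly set) \<noteq> mono_ideal n ?M"
    proof (rule mono_ideal_antichain_minimal[OF Mk _ \<open>N \<subset> ?M\<close>])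
      fix m m' assume "m \<in> ?M" "m' \<in> ?M" and le: "\<forall>i. lookup m i \<le> lookup m' i"
      then obtain x y where x: "x \<in> corners n e" "m = corner_mono n x"
        and y: "y \<in> corners n e" "m' = corner_mono n y" by blast
      show "m = m'" using corner_mono_antichain[OF n x(1) y(1)] le by (simp add: x y)
    qed
    then show "(mono_ideal n N :: (nat, 'k) mpoly set) \<noteq> mono_ideal n (nonstandard n e)"
      by (simp add: M)
  qed (use Mk M in auto)
  ultimately show ?thesis by (simp add: minimal_groebner_basis_def lead init)
qed

section \<open>The explicit bases and the conclusion\<close>

lemma image_Collect_2: "f ` {g x y | x y. P x y} = {f (g x y) | x y. P x y}"
  by blast

text \<open>For even \<open>e\<close> the value \<open>e + 1\<close> makes \<open>j\<close> odd,
  which gives the second family; the alternative with \<open>j = 0\<close> gives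
  \<open>mdeg a = d + 1\<close>, the first family.\<close>

lemma G_even_eq_corners: "(G_even n d :: (nat, 'k::field_char_0) mpoly set) = corner_poly n ` corners n (2 * d)"
proof -
  have "corners n (2 * d) = {(0, a) | a. a \<in> multi_indices (n - 1) (d + 1)} \<union>
      {(2 * i + 1, a) | i a. i \<le> d \<and> a \<in> multi_indices (n - 1) (d - i)}" (is "_ = ?R")
  proof
    show "corners n (2 * d) \<subseteq> ?R"
    proof
      fix x assume "x \<in> corners n (2 * d)"
      then obtain j a where x: "x = (j, a)" "keys a \<subseteq> {1..n - 1}"
          "j + 2 * mdeg a = 2 * d + 1 \<or> j = 0 \<and> 2 * mdeg a = 2 * d + 2"
        by (auto simp: corners_def)
      show "x \<in> ?R"
      proof (cases "j = 0")
        case False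
        then have "j = 2 * (d - mdeg a) + 1" "mdeg a = d - (d - mdeg a)" using x(3) by presburger+
        then show ?thesis using x(1,2) by (auto simp: multi_indices_def intro!: exI[of _ "d - mdeg a"])
      next
        case True
        then have "mdeg a = d + 1" using x(3) by presburger
        then show ?thesis using x(1,2) True by (auto simp: multi_indices_def)
      qed
    qed
  qed (auto simp: corners_def multi_indices_def)
  moreover have "corner_poly n ` {(0, a) | a. a \<in> A} = {phi (F n a :: (nat, 'k) mpoly) | a. a \<in> A}" for A
    by (simp add: Setcompr_eq_image image_image corner_poly_def)
  moreover have "corner_poly n ` {(2 * i + 1, a) | i a. P i a}
      = {phi (Var n ^ (2 * i + 1) * F n a :: (nat, 'k) mpoly) | i a. P i a}" for P
    by (simp only: image_Collect_2 corner_poly_def prod.case)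
  ultimately show ?thesis by (simp only: G_even_def image_Un)
qed

text \<open>Here \<open>e + 2\<close> is odd, so only the value \<open>e + 1 = 2 * d + 2\<close>
  occurs, and \<open>j\<close> is even.\<close>

lemma G_odd_eq_corners: "G_odd n d = corner_poly n ` corners n (2 * d + 1)"
proof -
  have "corners n (2 * d + 1) = {(2 * i, a) | i a. i \<le> d + 1 \<and> a \<in> multi_indices (n - 1) (d + 1 - i)}"
    (is "_ = ?R")
  proof
    show "corners n (2 * d + 1) \<subseteq> ?R"
    proof
      fix x assume "x \<in> corners n (2 * d + 1)"
      then obtain j a where x: "x = (j, a)" "keys a \<subseteq> {1..n - 1}" "j + 2 * mdeg a = 2 * d + 2"
        by (auto simp: corners_def) presburger
      then have "j = 2 * (d + 1 - mdeg a)" "mdeg a = d + 1 - (d + 1 - mdeg a)" by presburger+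
      then show "x \<in> ?R" using x(1,2)
        by (auto simp: multi_indices_def intro!: exI[of _ "d + 1 - mdeg a"])
    qed
  qed (auto simp: corners_def multi_indices_def)
  then show ?thesis by (simp only: G_odd_def image_Collect_2 corner_poly_def prod.case)
qed

theorem theorem3p4:
  fixes n e :: nat
  assumes "n \<ge> 1" and "e \<ge> 1"
  shows "generic_form n e (\<lambda>G :: (nat, 'k::field_char_0) mpoly.
           initial_ideal n (Ann n G) = initial_ideal n (Ann n (complete_sym n e))) \<and>
         (\<forall>d. e = 2 * d \<longrightarrow>
           minimal_groebner_basis n (G_even n d :: (nat, 'k) mpoly set) (Ann n (complete_sym n (2 * d)))) \<and>
         (\<forall>d. e = 2 * d + 1 \<longrightarrow>
           minimal_groebner_basis n (G_odd n d :: (nat, 'k) mpoly set) (Ann n (complete_sym n (2 * d + 1))))"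
proof (intro conjI allI impI)
  let ?H = "complete_sym n e :: (nat, 'k) mpoly"
  have lead: "lead_mono ` (Ann n G - {0}) = nonstandard n e"
    if "G \<in> forms n e" "nondegenerate n e G" for G :: "(nat, 'k) mpoly"
    using lead_monos_Ann[OF assms(1) that] .
  \<comment> \<open>The form \<open>H_e\<close> itself witnesses that the genericity condition is
    given by a nonzero polynomial.\<close>
  have "poly_eval (discriminant n e) (lookup ?H) \<noteq> 0"
    unfolding poly_eval_discriminant by (rule nondegenerate_complete_sym[OF assms(1)])
  then have "(discriminant n e :: (nat mono, 'k) mpoly) \<noteq> 0" by (auto simp: poly_eval_def)
  then show "generic_form n e (\<lambda>G :: (nat, 'k) mpoly.
      initial_ideal n (Ann n G) = initial_ideal n (Ann n (complete_sym n e)))"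
    unfolding generic_form_def using vars_discriminant[OF assms(1)]
    by (intro exI[of _ "discriminant n e"])
      (simp add: poly_eval_discriminant initial_ideal_def lead complete_sym_forms
        nondegenerate_complete_sym[OF assms(1)])
qed (simp_all add: G_even_eq_corners G_odd_eq_corners minimal_groebner_basis_corners[OF assms(1)])

end
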